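(* Let $n\ge 2$, let $X=\sum_{i=1}^n a_i\,\partial/\partial\theta_i$ be a constant vector field on $T^n$ whose coefficients $a_1,\dots,a_n\in\mathbb{R}$ are independent over $\mathbb{Q}$, and let $\phi$ be the flow on $T^n$ generated by $X$. Then for any subgroup $\Lambda<\rho_\phi(S_\phi)$ with $\Lambda\neq\{1\}$, the group $\rho_\phi^{-1}(\Lambda)$ is the internal semidirect product of a subgroup isomorphic to the abelian group $T^n$ by a subgroup isomorphic to a multiplicative abelian group of real algebraic integers of degree at most $n$, which multiplicative group is isomorphic to an abelian subgroup of $\mathrm{GL}(n,\mathbb{Z})$.
   Context: $T^n=\mathbb{R}^n/\mathbb{Z}^n$ with coordinates $\theta_i=x_i \bmod 1$. $\mathrm{Diff}(T^n)$ is the group of $C^\infty$ diffeomorphisms of $T^n$ under composition. Real numbers $a_1,\dots,a_n$ are independent over $\mathbb{Q}$ if $\sum_j m_ja_j=0$ with $m_j\in\mathbb{Z}$ implies all $m_j=0$. For a flow $\phi$ on $T^n$ generated by $X$, let $F_\phi=\{\phi_t:t\in\mathbb{R}\}$; the generalized symmetry group $S_\phi$ is the normalizer of $F_\phi$ in $\mathrm{Diff}(T^n)$. For $R\in\mathrm{Diff}(T^n)$, $R_*X=\mathbf{T}R\circ X\circ R^{-1}$, where $\mathbf{T}$ is the tangent functor. It is known that $R\in S_\phi$ if and only if there is a unique $\alpha\in\mathbb{R}^*=\mathbb{R}\setminus\{0\}$ with $R_*X=\alpha X$ (equivalently $R\phi_t=\phi_{\alpha t}R$ for all $t\in\mathbb{R}$).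 The multiplier representation $\rho_\phi:S_\phi\to\mathbb{R}^*$ is the homomorphism sending $R$ to this $\alpha$; its image $\rho_\phi(S_\phi)$ is the multiplier group of $\phi$. An algebraic integer has degree $m$ if $m$ is the smallest degree of a monic polynomial in $\mathbb{Z}[z]$ of which it is a root. A group $G$ is the internal semidirect product of a subgroup $N$ by a subgroup $H$ if $N$ is normal in $G$, $NH=G$ and $N\cap H$ is trivial. "$<$" denotes "is a subgroup of" (not necessarily proper). *)

theory Defs
  imports "HOL-Analysis.Analysis" "HOL-Algebra.Group_Action"
begin

subsection \<open>The torus\<close>

text \<open>
  The torus \<open>\<real>\<^sup>n / \<int>\<^sup>n\<close>. The dimension \<open>n\<close> is the cardinality of the index type.
\<close>

definition lattice_rel :: "real ^ 'n \<Rightarrow> real ^ 'n \<Rightarrow> bool" where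
  "lattice_rel x y \<longleftrightarrow> (\<forall>i. x $ i - y $ i \<in> \<int>)"

lemma equivp_lattice_rel: "equivp (lattice_rel :: real ^ 'n \<Rightarrow> real ^ 'n \<Rightarrow> bool)"
proof (rule equivpI)
  show "reflp (lattice_rel :: real ^ 'n \<Rightarrow> real ^ 'n \<Rightarrow> bool)"
    by (rule reflpI) (simp add: lattice_rel_def)
  show "symp (lattice_rel :: real ^ 'n \<Rightarrow> real ^ 'n \<Rightarrow> bool)"
    unfolding lattice_rel_def by (rule sympI) (metis Ints_minus minus_diff_eq)
  show "transp (lattice_rel :: real ^ 'n \<Rightarrow> real ^ 'n \<Rightarrow> bool)"
  proof (rule transpI)
    fix x y z :: "real ^ 'n"
    assume "lattice_rel x y" "lattice_rel y z"
    then have "(x $ i - y $ i) + (y $ i - z $ i) \<in> \<int>" for i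
      unfolding lattice_rel_def by (blast intro: Ints_add)
    then show "lattice_rel x z"
      by (simp add: lattice_rel_def)
  qed
qed

quotient_type (overloaded) 'n torus = "real ^ 'n::finite" / lattice_rel
  by (rule equivp_lattice_rel)

lift_definition torus_proj :: "real ^ 'n \<Rightarrow> 'n::finite torus" is "\<lambda>x. x" .

instantiation torus :: (finite) ab_group_add
begin

lift_definition zero_torus :: "'a torus" is 0 .

lift_definition plus_torus :: "'a torus \<Rightarrow> 'a torus \<Rightarrow> 'a torus" is "(+)"
  unfolding lattice_rel_def by (metis Ints_add add_diff_add vector_add_component)

lift_definition uminus_torus :: "'a torus \<Rightarrow> 'a torus" is uminus
  unfolding lattice_rel_def by (metis Ints_minus minus_diff_minus vector_uminus_component)

definition minus_torus :: "'a torus \<Rightarrow> 'a torus \<Rightarrow> 'a torus" where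
  "minus_torus p q = p + (- q)"

instance
proof
  fix p q r :: "'a torus"
  show "p + q + r = p + (q + r)"
    by transfer (simp add: lattice_rel_def)
  show "p + q = q + p"
    by transfer (simp add: lattice_rel_def)
  show "0 + p = p"
    by transfer (simp add: lattice_rel_def)
  show "- p + p = 0"
    by transfer (simp add: lattice_rel_def)
  show "p - q = p + - q"
    by (rule minus_torus_def)
qed

end

definition torus_group :: "'n::finite torus monoid" where
  "torus_group = \<lparr>carrier = UNIV, mult = (+), one = 0\<rparr>"


subsection \<open>Diffeomorphisms\<close>

text \<open>
  \<open>C\<^sup>k\<close> functions on an open subset of a Euclidean space: all iterated directional
  derivatives up to order \<open>k\<close> exist and are continuous.
\<close>

primrec Ck_on :: "nat \<Rightarrow> ('a::euclidean_space \<Rightarrow> 'b::euclidean_space) \<Rightarrow> 'a set \<Rightarrow> bool" where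
  "Ck_on 0 f U \<longleftrightarrow> continuous_on U f"
| "Ck_on (Suc k) f U \<longleftrightarrow>
     (\<forall>x\<in>U. f differentiable (at x)) \<and> (\<forall>v. Ck_on k (\<lambda>x. frechet_derivative f (at x) v) U)"

definition Cinf_on :: "('a::euclidean_space \<Rightarrow> 'b::euclidean_space) \<Rightarrow> 'a set \<Rightarrow> bool" where
  "Cinf_on f U \<longleftrightarrow> (\<forall>k. Ck_on k f U)"

text \<open>
  The charts of the torus are the local inverses of the projection \<open>torus_proj\<close>, so a map of
  the torus is expressed in charts by its local lifts to \<open>\<real>\<^sup>n\<close>.
\<close>

definition local_lift ::
    "('n::finite torus \<Rightarrow> 'n torus) \<Rightarrow> (real ^ 'n) set \<Rightarrow> (real ^ 'n \<Rightarrow> real ^ 'n) \<Rightarrow> bool" where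
  "local_lift R U F \<longleftrightarrow> open U \<and> (\<forall>y\<in>U. R (torus_proj y) = torus_proj (F y))"

definition torus_smooth :: "('n::finite torus \<Rightarrow> 'n torus) \<Rightarrow> bool" where
  "torus_smooth R \<longleftrightarrow> (\<forall>x. \<exists>U F. x \<in> U \<and> local_lift R U F \<and> Cinf_on F U)"

definition torus_diffeo :: "('n::finite torus \<Rightarrow> 'n torus) \<Rightarrow> bool" where
  "torus_diffeo R \<longleftrightarrow> bij R \<and> torus_smooth R \<and> torus_smooth (inv_into UNIV R)"

definition Diff_torus :: "('n::finite torus \<Rightarrow> 'n torus) monoid" where
  "Diff_torus = \<lparr>carrier = {R. torus_diffeo R}, mult = (\<circ>), one = id\<rparr>"


subsection \<open>Tangent vectors, vector fields and flows\<close>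

text \<open>
  The tangent bundle of the torus is identified with \<open>T\<^sup>n \<times> \<real>\<^sup>n\<close> by means of the global frame
  \<open>\<partial>/\<partial>\<theta>\<^sub>1, \<dots>, \<partial>/\<partial>\<theta>\<^sub>n\<close>: the pair \<open>(p, v)\<close> is the tangent vector \<open>\<Sum>\<^sub>i v\<^sub>i \<partial>/\<partial>\<theta>\<^sub>i\<close> at \<open>p\<close>.
  A vector field is a section of this bundle.
\<close>

type_synonym 'n tangent = "'n torus \<times> (real ^ 'n)"
type_synonym 'n vfield = "'n torus \<Rightarrow> 'n tangent"

definition constant_field :: "real ^ 'n \<Rightarrow> 'n::finite vfield" where
  "constant_field a = (\<lambda>p. (p, a))"

definition scale_field :: "real \<Rightarrow> 'n::finite vfield \<Rightarrow> 'n vfield" where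
  "scale_field \<alpha> X = (\<lambda>p. (fst (X p), \<alpha> *\<^sub>R snd (X p)))"

text \<open>
  The derivative at \<open>p\<close> does not depend on the local lift or on the point above \<open>p\<close>, since two
  lifts differ by a locally constant integer vector.
\<close>

definition torus_derivative ::
    "('n::finite torus \<Rightarrow> 'n torus) \<Rightarrow> 'n torus \<Rightarrow> (real ^ 'n \<Rightarrow> real ^ 'n)" where
  "torus_derivative R p = (THE L. \<exists>x U F. torus_proj x = p \<and> x \<in> U \<and> local_lift R U F \<and>
     (F has_derivative L) (at x))"

definition tangent_map :: "('n::finite torus \<Rightarrow> 'n torus) \<Rightarrow> 'n tangent \<Rightarrow> 'n tangent" where
  "tangent_map R = (\<lambda>(p, v). (R p, torus_derivative R p v))"

definition pushforward :: "('n::finite torus \<Rightarrow> 'n torus) \<Rightarrow> 'n vfield \<Rightarrow> 'n vfield" where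
  "pushforward R X = tangent_map R \<circ> X \<circ> inv_into UNIV R"

definition has_velocity :: "(real \<Rightarrow> 'n::finite torus) \<Rightarrow> real \<Rightarrow> 'n tangent \<Rightarrow> bool" where
  "has_velocity c t w \<longleftrightarrow> fst w = c t \<and>
     (\<exists>\<gamma>. (\<forall>\<^sub>F s in nhds t. c s = torus_proj (\<gamma> s)) \<and> (\<gamma> has_vector_derivative snd w) (at t))"

definition flow_generated_by ::
    "'n::finite vfield \<Rightarrow> (real \<Rightarrow> 'n torus \<Rightarrow> 'n torus) \<Rightarrow> bool" where
  "flow_generated_by X \<phi> \<longleftrightarrow> \<phi> 0 = id \<and> (\<forall>s t. \<phi> (s + t) = \<phi> s \<circ> \<phi> t) \<and>
     (\<forall>p t. has_velocity (\<lambda>s. \<phi> s p) t (X (\<phi> t p)))"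


subsection \<open>Generalized symmetries and multipliers\<close>

definition gen_symmetry :: "(real \<Rightarrow> 'n::finite torus \<Rightarrow> 'n torus) \<Rightarrow> ('n torus \<Rightarrow> 'n torus) set" where
  "gen_symmetry \<phi> = normalizer Diff_torus (range \<phi>)"

definition real_units :: "real monoid" where
  "real_units = \<lparr>carrier = {x. x \<noteq> 0}, mult = (*), one = 1\<rparr>"

text \<open>
  Here \<open>X\<close> is the generator of the flow; the multiplier is determined on \<open>gen_symmetry \<phi>\<close>.
\<close>

definition multiplier :: "'n::finite vfield \<Rightarrow> ('n torus \<Rightarrow> 'n torus) \<Rightarrow> real" where
  "multiplier X R = (THE \<alpha>. \<alpha> \<noteq> 0 \<and> pushforward R X = scale_field \<alpha> X)"

definition multiplier_group ::
    "'n::finite vfield \<Rightarrow> (real \<Rightarrow> 'n torus \<Rightarrow> 'n torus) \<Rightarrow> real monoid" where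
  "multiplier_group X \<phi> = real_units\<lparr>carrier := multiplier X ` gen_symmetry \<phi>\<rparr>"

definition multiplier_preimage ::
    "'n::finite vfield \<Rightarrow> (real \<Rightarrow> 'n torus \<Rightarrow> 'n torus) \<Rightarrow> real set \<Rightarrow> ('n torus \<Rightarrow> 'n torus) monoid" where
  "multiplier_preimage X \<phi> \<Lambda> =
     Diff_torus\<lparr>carrier := {R \<in> gen_symmetry \<phi>. multiplier X R \<in> \<Lambda>}\<rparr>"


subsection \<open>Algebra\<close>

definition independent_over_rat :: "real ^ 'n \<Rightarrow> bool" where
  "independent_over_rat a \<longleftrightarrow>
     (\<forall>m :: 'n \<Rightarrow> int. (\<Sum>j\<in>UNIV. of_int (m j) * a $ j) = 0 \<longrightarrow> (\<forall>j. m j = 0))"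

text \<open>Meaningful for algebraic integers only.\<close>

definition algebraic_int_degree :: "real \<Rightarrow> nat" where
  "algebraic_int_degree x =
     (LEAST m. \<exists>p :: int poly. lead_coeff p = 1 \<and> degree p = m \<and> poly (map_poly of_int p) x = 0)"

definition GL_int :: "(int ^ 'n ^ 'n) monoid" where
  "GL_int = \<lparr>carrier = {A. invertible A}, mult = (**), one = mat 1\<rparr>"

definition internal_semidirect :: "('a, 'b) monoid_scheme \<Rightarrow> 'a set \<Rightarrow> 'a set \<Rightarrow> bool" where
  "internal_semidirect G N H \<longleftrightarrow> N \<lhd> G \<and> subgroup H G \<and> N <#>\<^bsub>G\<^esub> H = carrier G \<and>
     N \<inter> H = {\<one>\<^bsub>G\<^esub>}"

end

theory Submission
  imports Defs
begin

text \<open>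
  A generalized symmetry \<open>R\<close> carries each \<open>\<phi>\<^sub>t\<close> to some \<open>\<phi>\<^sub>s\<close>, so \<open>h p = R p - R 0\<close> satisfies
  \<open>h (p + q) = h p + h q\<close> for \<open>q\<close> on the orbit of \<open>0\<close>. By Kronecker's theorem that orbit is
  dense, hence \<open>h\<close> is a smooth automorphism of the torus, i.e. an integer matrix \<open>B\<close> invertible
  over \<open>\<int>\<close>. It maps the line \<open>\<real>a\<close> into \<open>\<real>a + \<int>\<^sup>n\<close>, and countability of \<open>\<int>\<^sup>n\<close> gives \<open>B a = \<alpha> a\<close>; the
  multiplier of \<open>R\<close> is \<open>\<alpha>\<close>. By rational independence \<open>\<alpha>\<close> determines \<open>B\<close>, so the kernel of the
  multiplier representation consists of the translations, the linear maps \<open>B\<close> form a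
  complement isomorphic to \<open>\<Lambda>\<close>, and \<open>\<alpha>\<close> is a root of the characteristic polynomial of \<open>B\<close>.
\<close>

subsection \<open>Integer matrices acting on the torus\<close>

abbreviation real_mat :: "int ^ 'n ^ 'm \<Rightarrow> real ^ 'n ^ 'm" where
  "real_mat \<equiv> map_matrix of_int"

lemma torus_proj_eq_iff: "torus_proj x = torus_proj y \<longleftrightarrow> (\<forall>i. x $ i - y $ i \<in> \<int>)"
  by transfer (simp add: lattice_rel_def)

lemma torus_proj_add: "torus_proj (x + y) = torus_proj x + torus_proj y"
  by transfer (simp add: lattice_rel_def)

lemma torus_proj_minus: "torus_proj (- x) = - torus_proj x"
  by transfer (simp add: lattice_rel_def)

lemma torus_proj_diff: "torus_proj (x - y) = torus_proj x - torus_proj y"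
  by (metis torus_proj_add torus_proj_minus add_uminus_conv_diff)

lemma torus_proj_0: "torus_proj 0 = 0"
  by transfer (simp add: lattice_rel_def)

lemma torus_proj_eq_0_iff: "torus_proj x = 0 \<longleftrightarrow> (\<forall>i. x $ i \<in> \<int>)"
  by (metis (no_types, lifting) diff_zero torus_proj_0 torus_proj_eq_iff zero_index)

lemma torus_proj_surj: obtains x where "torus_proj x = p"
  by (metis Quotient_abs_rep Quotient_torus eq_id_iff map_fun_apply torus_proj_def)

text \<open>If some component of \<open>v\<close> were nonzero, \<open>t = 1 / (2 * v $ i)\<close>
  would scale it to 1/2, which is not an integer.\<close>

lemma torus_proj_line_eq_0:
  assumes "\<And>t. torus_proj (t *\<^sub>R v) = 0"
  shows "v = 0"
proof -
  have "v $ i = 0" for i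
  proof (rule ccontr)
    assume "v $ i \<noteq> 0"
    moreover have "(1 / (2 * v $ i)) * v $ i \<in> \<int>"
      using assms[of "1 / (2 * v $ i)"] by (metis torus_proj_eq_0_iff vector_scaleR_component real_scaleR_def)
    ultimately have "1 / 2 \<in> (\<int> :: real set)" by simp
    then obtain k :: int where "1 / 2 = (of_int k :: real)" by (auto elim: Ints_cases)
    then have "of_int (2 * k) = (1 :: real)" by simp
    then show False by (metis of_int_eq_1_iff odd_one even_mult_iff even_numeral)
  qed
  then show ?thesis by (simp add: vec_eq_iff)
qed

lemma real_mat_mult: "real_mat (A ** B) = real_mat A ** real_mat B"
  by (simp add: vec_eq_iff matrix_matrix_mult_def)

lemma real_mat_1: "real_mat (mat 1) = mat 1"
  by (simp add: vec_eq_iff mat_def)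

lemma real_mat_mult_Ints:
  assumes "\<forall>i. x $ i \<in> \<int>"
  shows "(real_mat B *v x) $ i \<in> \<int>"
  using assms by (auto simp: matrix_vector_mult_def intro!: Ints_sum Ints_mult)

lift_definition torus_lin :: "int ^ 'n ^ 'n \<Rightarrow> 'n::finite torus \<Rightarrow> 'n torus"
  is "\<lambda>B x. real_mat B *v x"
proof -
  fix B :: "int ^ 'n ^ 'n" and x y :: "real ^ 'n"
  assume "lattice_rel x y"
  then have "\<forall>i. (x - y) $ i \<in> \<int>" by (simp add: lattice_rel_def)
  from real_mat_mult_Ints[OF this, of B]
  show "lattice_rel (real_mat B *v x) (real_mat B *v y)"
    by (simp add: lattice_rel_def matrix_vector_mult_diff_distrib)
qed

lemma torus_lin_proj: "torus_lin B (torus_proj x) = torus_proj (real_mat B *v x)"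
  by transfer (simp add: lattice_rel_def)

lemma torus_lin_add: "torus_lin B (p + q) = torus_lin B p + torus_lin B q"
  by (metis torus_proj_surj torus_proj_add torus_lin_proj matrix_vector_right_distrib)

lemma torus_lin_0 [simp]: "torus_lin B 0 = 0"
  by (metis add_cancel_right_right torus_lin_add)

lemma torus_lin_minus: "torus_lin B (- p) = - torus_lin B p"
  by (metis add.right_inverse minus_unique torus_lin_0 torus_lin_add)

lemma torus_lin_mult: "torus_lin (A ** B) p = torus_lin A (torus_lin B p)"
  by (metis torus_proj_surj torus_lin_proj real_mat_mult matrix_vector_mul_assoc)

lemma torus_lin_1 [simp]: "torus_lin (mat 1) p = p"
  by (metis torus_proj_surj torus_lin_proj real_mat_1 matrix_vector_mul_lid)

text \<open>Where two such maps agree, the difference of the two real matrices sends every line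
  through the origin into the lattice, and a line inside the lattice is trivial.\<close>

lemma torus_lin_inject:
  assumes "\<And>p. torus_lin A p = torus_lin B p"
  shows "A = B"
proof -
  have "real_mat A *v x - real_mat B *v x = 0" for x
  proof (rule torus_proj_line_eq_0)
    fix t
    show "torus_proj (t *\<^sub>R (real_mat A *v x - real_mat B *v x)) = 0"
      using assms[of "torus_proj (t *\<^sub>R x)"]
      by (simp add: torus_lin_proj scaleR_diff_right torus_proj_diff scaleR_matrix_vector_assoc
          matrix_vector_mult_scaleR)
  qed
  then have "real_mat A = real_mat B" by (simp add: matrix_eq)
  then show ?thesis by (simp add: vec_eq_iff)
qed

section \<open>Affine maps of the torus\<close>

definition torus_affine :: "int ^ 'n ^ 'n \<Rightarrow> 'n::finite torus \<Rightarrow> 'n torus \<Rightarrow> 'n torus" where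
  "torus_affine B c = (\<lambda>p. torus_lin B p + c)"

lemma torus_affine_comp:
  "torus_affine A c \<circ> torus_affine B d = torus_affine (A ** B) (torus_lin A d + c)"
  by (simp add: torus_affine_def fun_eq_iff torus_lin_mult torus_lin_add add.assoc)

lemma torus_affine_id: "torus_affine (mat 1) 0 = id"
  by (simp add: torus_affine_def fun_eq_iff)

lemma torus_affine_eq_iff: "torus_affine A c = torus_affine B d \<longleftrightarrow> A = B \<and> c = d"
proof
  assume *: "torus_affine A c = torus_affine B d"
  then have "c = d" by (metis torus_affine_def add_0 torus_lin_0)
  with * have "\<And>p. torus_lin A p = torus_lin B p"
    by (metis torus_affine_def add_right_cancel)
  with \<open>c = d\<close> show "A = B \<and> c = d" using torus_lin_inject by blast
qed simp

lemma torus_affine_inverse: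
  assumes "A ** B = mat 1" "B ** A = mat 1"
  shows "torus_affine A c \<circ> torus_affine B (- torus_lin B c) = id"
    and "torus_affine B (- torus_lin B c) \<circ> torus_affine A c = id"
  using assms by (simp_all add: torus_affine_comp torus_lin_minus flip: torus_lin_mult torus_affine_id)

subsection \<open>Affine maps are diffeomorphisms\<close>

lemma Ck_on_const: "Ck_on k (\<lambda>x. c) U"
  by (induction k arbitrary: c) (auto simp: frechet_derivative_const)

text \<open>The derivative is \<open>f\<close> at every point, so all directional derivatives are
  constant functions and a case split on \<open>k\<close> replaces an induction.\<close>

lemma Ck_on_affine:
  assumes "bounded_linear f"
  shows "Ck_on k (\<lambda>x. f x + c) U"
proof (cases k)
  case 0
  then show ?thesis using assms
    by (simp add: continuous_on_add linear_continuous_on)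
next
  case (Suc m)
  have "((\<lambda>x. f x + c) has_derivative f) (at x)" for x
    by (auto intro!: derivative_eq_intros bounded_linear_imp_has_derivative[OF assms])
  moreover from this have "frechet_derivative (\<lambda>x. f x + c) (at x) = f" for x
    by (metis frechet_derivative_at)
  ultimately show ?thesis
    unfolding Suc by (auto simp: differentiable_def Ck_on_const)
qed

lemma local_lift_torus_affine:
  "local_lift (torus_affine B (torus_proj c)) UNIV (\<lambda>x. real_mat B *v x + c)"
  by (simp add: local_lift_def torus_affine_def torus_lin_proj torus_proj_add)

lemma torus_smooth_affine: "torus_smooth (torus_affine B c)"
  unfolding torus_smooth_def Cinf_on_def
  by (metis torus_proj_surj local_lift_torus_affine Ck_on_affine matrix_vector_mul_bounded_linear UNIV_I)

lemma torus_diffeo_affine: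
  assumes "invertible B"
  shows "torus_diffeo (torus_affine B c)"
proof -
  obtain A where A: "B ** A = mat 1" "A ** B = mat 1"
    using assms by (auto simp: invertible_def)
  note inv = torus_affine_inverse[OF A, of c]
  have "bij (torus_affine B c)" using inv by (rule o_bij[rotated])
  moreover have "inv_into UNIV (torus_affine B c) = torus_affine A (- torus_lin A c)"
    using inv by (metis inv_unique_comp)
  ultimately show ?thesis by (simp add: torus_diffeo_def torus_smooth_affine)
qed

text \<open>The definite description in \<open>torus_derivative\<close> ranges over all local lifts.
  Any such lift differs from the affine lift \<open>?G\<close> by an integer vector, and continuity
  at the base point makes that vector constant nearby, so the two derivatives agree.\<close>

lemma torus_derivative_affine: "torus_derivative (torus_affine B c) p = (\<lambda>v. real_mat B *v v)"
proof -
  obtain d where d: "torus_proj d = c" by (rule torus_proj_surj)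
  obtain x0 where x0: "torus_proj x0 = p" by (rule torus_proj_surj)
  let ?G = "\<lambda>x. real_mat B *v x + d"
  have G: "(?G has_derivative (\<lambda>v. real_mat B *v v)) (at x)" for x
    by (auto intro!: derivative_eq_intros bounded_linear_imp_has_derivative matrix_vector_mul_bounded_linear)
  show ?thesis
    unfolding torus_derivative_def
  proof (rule the_equality)
    show "\<exists>x U F. torus_proj x = p \<and> x \<in> U \<and> local_lift (torus_affine B c) U F \<and>
        (F has_derivative (\<lambda>v. real_mat B *v v)) (at x)"
      using x0 d G local_lift_torus_affine by blast
  next
    fix L
    assume "\<exists>x U F. torus_proj x = p \<and> x \<in> U \<and> local_lift (torus_affine B c) U F \<and>
        (F has_derivative L) (at x)"
    then obtain x U F where F: "x \<in> U" "open U"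
        "\<And>y. y \<in> U \<Longrightarrow> torus_affine B c (torus_proj y) = torus_proj (F y)"
        "(F has_derivative L) (at x)"
      by (auto simp: local_lift_def)
    have int: "F y $ i - ?G y $ i \<in> \<int>" if "y \<in> U" for y i
    proof -
      have "torus_proj (F y) = torus_proj (?G y)"
        using F(3)[OF that] d by (simp add: torus_affine_def torus_lin_proj torus_proj_add)
      then show ?thesis using torus_proj_eq_iff by blast
    qed
    have D: "((\<lambda>y. F y - ?G y) has_derivative (\<lambda>v. L v - real_mat B *v v)) (at x)"
      using F(4) G by (rule has_derivative_diff)
    \<comment> \<open>Radius 1 is enough: two integers at distance less than 1 coincide.\<close>
    have "\<forall>\<^sub>F y in nhds x. dist (F y - ?G y) (F x - ?G x) < 1"
      using has_derivative_continuous[OF D] tendsto_at_iff_tendsto_nhds[of "\<lambda>y. F y - ?G y" x]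
      by (intro tendstoD) (auto simp: isCont_def)
    moreover have "\<forall>\<^sub>F y in nhds x. y \<in> U"
      using F by (simp add: eventually_nhds_in_open)
    ultimately have ev: "\<forall>\<^sub>F y in nhds x. F y - ?G y = F x - ?G x"
    proof eventually_elim
      case (elim y)
      have "(F y - ?G y) $ i = (F x - ?G x) $ i" for i
      proof -
        have "\<bar>(F y - ?G y) $ i - (F x - ?G x) $ i\<bar> < 1"
          using elim(1) component_le_norm_cart[of "(F y - ?G y) - (F x - ?G x)" i]
          by (simp add: dist_norm)
        moreover have "(F y - ?G y) $ i - (F x - ?G x) $ i \<in> \<int>"
          using int[OF elim(2)] int[OF F(1)] by (metis Ints_diff vector_minus_component)
        ultimately show ?thesis using Ints_nonzero_abs_less1 by fastforce
      qed
      then show ?case by (simp add: vec_eq_iff)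
    qed
    have "((\<lambda>y. F x - ?G x) has_derivative (\<lambda>v. L v - real_mat B *v v)) (at x)"
      by (rule has_derivative_transform_eventually[OF D])
        (use ev in \<open>auto simp: eventually_at_filter elim: eventually_mono\<close>)
    then have "(\<lambda>v. L v - real_mat B *v v) = (\<lambda>v. 0)"
      using has_derivative_unique has_derivative_const by blast
    then show "L = (\<lambda>v. real_mat B *v v)" by (simp add: fun_eq_iff)
  qed
qed

subsection \<open>Density of the orbits\<close>

lemma independent_over_rat_nonzero:
  assumes "independent_over_rat a"
  shows "a $ i \<noteq> 0"
proof
  assume "a $ i = 0"
  define m :: "'a \<Rightarrow> int" where "m j = of_bool (j = i)" for j
  have "(\<Sum>j\<in>UNIV. of_int (m j) * a $ j) = 0" using \<open>a $ i = 0\<close>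
    by (intro sum.neutral) (auto simp: m_def)
  then have "m i = 0" using assms unfolding independent_over_rat_def by blast
  then show False by (simp add: m_def)
qed

text \<open>Equal coordinates at \<open>i\<close> and \<open>k\<close> would give the relation
  \<open>a $ i - a $ k = 0\<close>. Kronecker's theorem asks for injectivity separately, since its
  independence hypothesis speaks of the set of numbers and not of the family.\<close>

lemma independent_over_rat_inj:
  assumes "independent_over_rat a"
  shows "inj (($) a)"
proof (rule injI, rule ccontr)
  fix i k assume "a $ i = a $ k" "i \<noteq> k"
  define m :: "'a \<Rightarrow> int" where "m j = of_bool (j = i) - of_bool (j = k)" for j
  have "(\<Sum>j\<in>UNIV. of_int (m j) * a $ j) = (\<Sum>j\<in>UNIV. of_bool (j = i) * a $ j) - (\<Sum>j\<in>UNIV. of_bool (j = k) * a $ j)"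
    by (simp add: m_def left_diff_distrib sum_subtractf)
  also have "\<dots> = 0" using \<open>a $ i = a $ k\<close>
    by (simp add: of_bool_def if_distrib[of "\<lambda>x. x * _"] cong: if_cong)
  finally have "m i = 0" using assms unfolding independent_over_rat_def by blast
  then show False using \<open>i \<noteq> k\<close> by (simp add: m_def)
qed

text \<open>Kronecker's simultaneous approximation with tolerance \<open>e / ?n\<close> in each
  coordinate; the sum of the coordinates' absolute values bounds the norm.\<close>

lemma line_dense:
  fixes a y :: "real ^ 'n"
  assumes a: "independent_over_rat a" and "e > 0"
  obtains t x where "torus_proj x = torus_proj (t *\<^sub>R a)" "norm (x - y) < e"
proof -
  let ?n = "CARD('n)"
  obtain f :: "nat \<Rightarrow> 'n" where f: "bij_betw f {..<?n} UNIV"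
    using ex_bij_betw_nat_finite[of "UNIV :: 'n set"] by (auto simp: atLeast0LessThan)
  define g where "g = inv_into {..<?n} f"
  have g: "g j < ?n" "f (g j) = j" for j
    using f bij_betw_inv_into_right[OF f] bij_betwE[OF bij_betw_inv_into[OF f]] by (auto simp: g_def)
  define \<theta> where "\<theta> = (\<lambda>i. a $ f i)"
  \<comment> \<open>The reals become a module over the integers, so that \<open>independent\<close>
    means the absence of integer relations.\<close>
  interpret Modules.module "\<lambda>r. (*) (real_of_int r)"
    by (simp add: Modules.module.intro distrib_left mult.commute)
  have "independent (\<theta> ` {..<?n})"
    unfolding independent_explicit_module
  proof (intro allI impI)
    fix T :: "real set" and u :: "real \<Rightarrow> int" and v
    assume T: "finite T" "T \<subseteq> \<theta> ` {..<?n}" "(\<Sum>v\<in>T. real_of_int (u v) * v) = 0" "v \<in> T"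
    \<comment> \<open>A relation \<open>u\<close> among the real numbers in \<open>T\<close> is
      pulled back to the index type and extended by 0.\<close>
    define m where "m j = (if a $ j \<in> T then u (a $ j) else 0)" for j
    have T_eq: "T = ($) a ` {j. a $ j \<in> T}" using T(2) by (auto simp: \<theta>_def)
    have "(\<Sum>j\<in>UNIV. of_int (m j) * a $ j) = (\<Sum>j | a $ j \<in> T. of_int (u (a $ j)) * a $ j)"
      by (rule sum.mono_neutral_cong_right) (auto simp: m_def)
    also have "\<dots> = (\<Sum>v\<in>($) a ` {j. a $ j \<in> T}. real_of_int (u v) * v)"
      using independent_over_rat_inj[OF a] by (subst sum.reindex) (auto simp: inj_on_def)
    also have "\<dots> = 0" using T(3) T_eq by simp
    finally have "\<forall>j. m j = 0" using a unfolding independent_over_rat_def by blast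
    then show "u v = 0" using T_eq T(4) m_def by (metis (mono_tags, lifting) imageE mem_Collect_eq)
  qed
  moreover have "inj_on \<theta> {..<?n}"
    using bij_betw_imp_inj_on[OF f] independent_over_rat_inj[OF a]
    by (auto simp: \<theta>_def inj_on_def)
  moreover have "e / ?n > 0" using \<open>e > 0\<close> by simp
  ultimately obtain t h where th: "\<And>i. i < ?n \<Longrightarrow> \<bar>t * \<theta> i - of_int (h i) - y $ f i\<bar> < e / ?n"
    using Kronecker_thm_1[of \<theta> ?n "e / ?n" "\<lambda>i. y $ f i"] by blast
  \<comment> \<open>This is \<open>t *\<^sub>R a\<close> moved by the lattice vector of the integers
    \<open>h\<close>, which brings it close to \<open>y\<close>.\<close>
  define x :: "real ^ 'n" where "x = (\<chi> j. t * a $ j - of_int (h (g j)))"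
  show thesis
  proof
    show "torus_proj x = torus_proj (t *\<^sub>R a)"
      by (simp add: torus_proj_eq_iff x_def)
    have "norm (x - y) \<le> (\<Sum>j\<in>UNIV. \<bar>(x - y) $ j\<bar>)" by (rule norm_le_l1_cart)
    also have "\<dots> < of_nat ?n * (e / ?n)"
    proof (rule sum_bounded_above_strict)
      fix j
      show "\<bar>(x - y) $ j\<bar> < e / ?n" using th[OF g(1)[of j]] by (simp add: x_def \<theta>_def g)
    qed simp
    finally show "norm (x - y) < e" by simp
  qed
qed

subsection \<open>Differentiable endomorphisms of the torus are linear\<close>

text \<open>The regularity on which the linearity argument runs: lifts continuous at a given point,
  and a derivative at 0. The lift may vary with the point.\<close>

definition torus_differentiable :: "('n::finite torus \<Rightarrow> 'n torus) \<Rightarrow> bool" where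
  "torus_differentiable R \<longleftrightarrow> (\<forall>x. \<exists>U F. x \<in> U \<and> local_lift R U F \<and> F differentiable (at x))"

lemma torus_smooth_imp_differentiable:
  assumes "torus_smooth R"
  shows "torus_differentiable R"
  unfolding torus_differentiable_def
proof
  fix x
  obtain U F where F: "x \<in> U" "local_lift R U F" "Cinf_on F U"
    using assms unfolding torus_smooth_def by blast
  then have "Ck_on (Suc 0) F U" by (simp only: Cinf_on_def)
  then show "\<exists>U F. x \<in> U \<and> local_lift R U F \<and> F differentiable (at x)"
    using F by auto
qed

text \<open>This permits normalizing a symmetry so that it fixes 0. Lifts of \<open>c\<close> and
  \<open>d\<close> turn a lift of \<open>R\<close> into one of the translated map.\<close>

lemma torus_differentiable_translate:
  assumes "torus_differentiable R"
  shows "torus_differentiable (\<lambda>p. R (p + c) + d)"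
  unfolding torus_differentiable_def
proof
  fix x
  obtain c' d' where cd: "torus_proj c' = c" "torus_proj d' = d"
    by (metis torus_proj_surj)
  obtain U F where F: "x + c' \<in> U" "local_lift R U F" "F differentiable (at (x + c'))"
    using assms unfolding torus_differentiable_def by blast
  let ?U = "(\<lambda>y. - c' + y) ` U" and ?F = "\<lambda>y. F (y + c') + d'"
  have "open ?U" using F(2) by (intro open_translation) (simp add: local_lift_def)
  moreover have "y + c' \<in> U" if "y \<in> ?U" for y
    using that by auto
  moreover have "R (torus_proj y + c) + d = torus_proj (F (y + c') + d')" if "y + c' \<in> U" for y
    using F(2) that cd torus_proj_add unfolding local_lift_def by metis
  ultimately have "local_lift (\<lambda>p. R (p + c) + d) ?U ?F"
    unfolding local_lift_def by blast
  moreover have "x \<in> ?U" using F(1) by (auto intro!: image_eqI[of _ _ "x + c'"])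
  moreover have "?F differentiable (at x)"
  proof -
    obtain L where L: "(F has_derivative L) (at (x + c'))" using F(3) by (auto simp: differentiable_def)
    have "((\<lambda>y. y + c') has_derivative (\<lambda>v. v)) (at x)" by (auto intro!: derivative_eq_intros)
    from has_derivative_compose[OF this L] have "((\<lambda>y. F (y + c')) has_derivative L) (at x)" .
    then have "(?F has_derivative L) (at x)" by (auto intro!: derivative_eq_intros)
    then show ?thesis by (auto simp: differentiable_def)
  qed
  ultimately show "\<exists>U F. x \<in> U \<and> local_lift (\<lambda>p. R (p + c) + d) U F \<and> F differentiable (at x)"
    by blast
qed

lemma torus_differentiableE:
  assumes "torus_differentiable R"
  obtains U F where "x \<in> U" "open U" "\<forall>z\<in>U. R (torus_proj z) = torus_proj (F z)"
    "F differentiable (at x)"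
proof -
  obtain U F where "x \<in> U" "local_lift R U F" "F differentiable (at x)"
    using assms unfolding torus_differentiable_def by blast
  then show thesis using that[of U F] unfolding local_lift_def by simp
qed

text \<open>The lattice is closed, coordinate by coordinate. Limits are taken on lifts, and this
  lemma brings an identity in the torus through the limit.\<close>

lemma torus_proj_limit_eq_0:
  assumes "X \<longlonglongrightarrow> x" "\<forall>\<^sub>F k in sequentially. torus_proj (X k) = 0"
  shows "torus_proj x = 0"
  unfolding torus_proj_eq_0_iff
proof
  fix i
  have "(\<lambda>k. X k $ i) \<longlonglongrightarrow> x $ i" using assms(1) by (rule tendsto_vec_nth)
  moreover have "\<forall>\<^sub>F k in sequentially. X k $ i \<in> \<int>"
    using assms(2) by eventually_elim (simp add: torus_proj_eq_0_iff)
  ultimately show "x $ i \<in> \<int>"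
    by (intro Lim_in_closed_set[OF closed_Ints _ sequentially_bot])
qed

text \<open>The points of the orbit of 0 are dense, so \<open>q\<close> is approached by them. The
  additivity defect, written with lifts, is a lattice vector along the sequence, and continuity of
  the lifts at \<open>y\<close> and \<open>x + y\<close> carries this to the limit.\<close>

lemma additive_if_additive_on_line:
  assumes a: "independent_over_rat a" and h: "torus_differentiable h"
    and add: "\<And>p t. h (p + torus_proj (t *\<^sub>R a)) = h p + h (torus_proj (t *\<^sub>R a))"
  shows "h (p + q) = h p + h q"
proof -
  obtain x y r where xyr: "torus_proj x = p" "torus_proj y = q" "torus_proj r = h p"
    by (metis torus_proj_surj)
  obtain U F where F: "y \<in> U" "open U" "\<forall>z\<in>U. h (torus_proj z) = torus_proj (F z)" "F differentiable (at y)"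
    using torus_differentiableE[OF h, of y] by blast
  obtain V G where G: "x + y \<in> V" "open V" "\<forall>z\<in>V. h (torus_proj z) = torus_proj (G z)"
      "G differentiable (at (x + y))"
    using torus_differentiableE[OF h, of "x + y"] by blast
  note cont = F(4)[THEN differentiable_imp_continuous_within] G(4)[THEN differentiable_imp_continuous_within]
  have "\<exists>z t. torus_proj z = torus_proj (t *\<^sub>R a) \<and> norm (z - y) < 1 / real (Suc k)" for k
    using line_dense[OF a, of "1 / real (Suc k)" y] by (metis of_nat_0_less_iff zero_less_Suc zero_less_divide_1_iff)
  then obtain Z T where Z: "\<And>k. torus_proj (Z k) = torus_proj (T k *\<^sub>R a)"
      "\<And>k. norm (Z k - y) < 1 / real (Suc k)" by metis
  have "(\<lambda>k. Z k - y) \<longlonglongrightarrow> 0"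
    by (rule tendsto_0_le[where K=1, OF lim_1_over_n[where 'a=real, THEN LIMSEQ_Suc]])
      (use Z(2) in \<open>auto intro!: always_eventually less_imp_le\<close>)
  then have lim: "Z \<longlonglongrightarrow> y" by (rule LIM_zero_cancel)
  then have lim': "(\<lambda>k. x + Z k) \<longlonglongrightarrow> x + y" by (intro tendsto_intros)
  have "(\<lambda>k. G (x + Z k) - r - F (Z k)) \<longlonglongrightarrow> G (x + y) - r - F y"
    using isCont_tendsto_compose[OF cont(1) lim] isCont_tendsto_compose[OF cont(2) lim']
    by (intro tendsto_diff tendsto_const)
  moreover have "\<forall>\<^sub>F k in sequentially. torus_proj (G (x + Z k) - r - F (Z k)) = 0"
    using topological_tendstoD[OF lim F(2,1)] topological_tendstoD[OF lim' G(2,1)]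
  proof eventually_elim
    case (elim k)
    have "torus_proj (G (x + Z k) - r - F (Z k))
        = h (torus_proj (x + Z k)) - h p - h (torus_proj (Z k))"
      using F(3)[rule_format, OF elim(1)] G(3)[rule_format, OF elim(2)] by (simp only: torus_proj_diff xyr)
    also have "\<dots> = 0"
      unfolding torus_proj_add xyr Z(1) add by simp
    finally show ?case .
  qed
  ultimately have "torus_proj (G (x + y) - r - F y) = 0" by (rule torus_proj_limit_eq_0)
  then have "h (p + q) - h p - h q = 0"
    using F(3)[rule_format, OF F(1)] G(3)[rule_format, OF G(1)] by (simp only: torus_proj_diff torus_proj_add xyr)
  then show ?thesis by (simp add: diff_diff_eq)
qed

text \<open>By additivity the value of \<open>h\<close> at a point is \<open>Suc k\<close> times its
  value at the point divided by \<open>Suc k\<close>. In lifts this is a difference quotient at 0,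
  so the derivative \<open>L\<close> of a local lift at 0 is a global lift of \<open>h\<close>. It
  sends basis vectors into the lattice, hence has an integer matrix.\<close>

lemma additive_differentiable_imp_torus_lin:
  fixes h :: "'n::finite torus \<Rightarrow> 'n torus"
  assumes h: "torus_differentiable h" and add: "\<And>p q. h (p + q) = h p + h q"
  obtains B where "h = torus_lin B"
proof -
  have h0: "h 0 = 0" using add[of 0 0] by simp
  obtain U F where F: "0 \<in> U" "open U" "\<forall>z\<in>U. h (torus_proj z) = torus_proj (F z)"
      "F differentiable (at 0)"
    using torus_differentiableE[OF h, of 0] by blast
  obtain L where L: "(F has_derivative L) (at 0)" using F(4) by (auto simp: differentiable_def)
  interpret L: bounded_linear L using L by (rule has_derivative_bounded_linear)
  have mult: "h (torus_proj (real k *\<^sub>R x)) = torus_proj (real k *\<^sub>R y)"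
    if "h (torus_proj x) = torus_proj y" for k x y
    by (induction k) (simp_all add: torus_proj_0 h0 scaleR_left_distrib torus_proj_add add that)
  have hL: "h (torus_proj x) = torus_proj (L x)" for x
  proof -
    obtain r where r: "torus_proj r = h (torus_proj x)" by (rule torus_proj_surj)
    define X where "X k = (1 / real (Suc k)) *\<^sub>R x" for k
    have inv0: "(\<lambda>k. 1 / real (Suc k)) \<longlonglongrightarrow> 0" using lim_1_over_n[where 'a=real, THEN LIMSEQ_Suc] .
    have X0: "X \<longlonglongrightarrow> 0" unfolding X_def
      using tendsto_scaleR[OF inv0 tendsto_const[of x]] by simp
    \<comment> \<open>The case \<open>x = 0\<close> is split off because the limit defining the
      derivative needs \<open>X k\<close> to avoid 0.\<close>
    have quot: "(\<lambda>k. real (Suc k) *\<^sub>R (F (X k) - F 0)) \<longlonglongrightarrow> L x"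
    proof (cases "x = 0")
      case True
      then show ?thesis by (simp add: X_def L.zero)
    next
      case False
      have "filterlim X (at 0) sequentially"
        unfolding filterlim_at using X0 False by (simp add: X_def)
      moreover have "((\<lambda>v. norm (F v - F 0 - L v) / norm v) \<longlongrightarrow> 0) (at 0)"
        using L by (simp add: has_derivative_at)
      ultimately have "(\<lambda>k. norm (F (X k) - F 0 - L (X k)) / norm (X k)) \<longlonglongrightarrow> 0"
        by (rule filterlim_compose[rotated])
      from tendsto_mult[OF this tendsto_const[of "norm x"]]
      have "(\<lambda>k. norm (F (X k) - F 0 - L (X k)) / norm (X k) * norm x) \<longlonglongrightarrow> 0" by simp
      moreover have "norm (F (X k) - F 0 - L (X k)) / norm (X k) * norm x
          = norm (real (Suc k) *\<^sub>R (F (X k) - F 0) - L x)" for k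
      proof -
        have "norm (real (Suc k) *\<^sub>R (F (X k) - F 0) - L x)
            = norm (real (Suc k) *\<^sub>R (F (X k) - F 0 - L (X k)))"
          by (simp add: X_def L.scaleR scaleR_diff_right del: of_nat_Suc)
        also have "\<dots> = real (Suc k) * norm (F (X k) - F 0 - L (X k))"
          by (simp del: of_nat_Suc)
        finally show ?thesis using False by (simp add: X_def divide_simps del: of_nat_Suc)
      qed
      ultimately have "(\<lambda>k. norm (real (Suc k) *\<^sub>R (F (X k) - F 0) - L x)) \<longlonglongrightarrow> 0"
        by simp
      then show ?thesis by (simp add: tendsto_norm_zero_iff LIM_zero_iff)
    qed
    have "(\<lambda>k. real (Suc k) *\<^sub>R (F (X k) - F 0) - r) \<longlonglongrightarrow> L x - r"
      using quot by (intro tendsto_intros)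
    moreover have "\<forall>\<^sub>F k in sequentially. torus_proj (real (Suc k) *\<^sub>R (F (X k) - F 0) - r) = 0"
      using topological_tendstoD[OF X0 F(2,1)]
    proof eventually_elim
      case (elim k)
      \<comment> \<open>\<open>F 0\<close> is a lattice vector since \<open>h 0 = 0\<close>, so
        subtracting it leaves the projection unchanged.\<close>
      have "h (torus_proj (X k)) = torus_proj (F (X k) - F 0)"
        using F(3)[rule_format, OF elim] F(3)[rule_format, OF F(1)] by (simp add: torus_proj_diff torus_proj_0 h0)
      from mult[OF this, of "Suc k"] show ?case
        by (simp add: torus_proj_diff r X_def del: of_nat_Suc)
    qed
    ultimately have "torus_proj (L x - r) = 0" by (rule torus_proj_limit_eq_0)
    then show ?thesis by (simp add: torus_proj_diff r)
  qed
  \<comment> \<open>The floor only changes the type from real to integer; the entries are shown to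
    be integers next.\<close>
  define B :: "int ^ 'n ^ 'n" where "B = (\<chi> i j. \<lfloor>L (axis j 1) $ i\<rfloor>)"
  have "L (axis j 1) $ i \<in> \<int>" for i j
  proof -
    have "torus_proj (axis j 1 :: real ^ 'n) = 0"
      by (simp add: torus_proj_eq_0_iff axis_def)
    then show ?thesis using hL[of "axis j 1"] h0 torus_proj_eq_0_iff by metis
  qed
  then have "real_mat B = matrix L"
    by (simp add: vec_eq_iff B_def matrix_def)
  then have "real_mat B *v x = L x" for x
    using fun_cong[OF matrix_vector_mul(3)[OF L.bounded_linear_axioms]] by simp
  then have "h (torus_proj x) = torus_lin B (torus_proj x)" for x
    by (simp add: hL torus_lin_proj)
  then have "h p = torus_lin B p" for p
    by (metis torus_proj_surj)
  then show thesis using that by blast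
qed

subsection \<open>The flow of a constant field\<close>

text \<open>The functions \<open>x \<mapsto> cis (2\<pi>x\<^sub>i)\<close> separate the points of the torus; along the difference of
  an orbit and the linear orbit they have derivative zero.\<close>

lemma flow_constant_field:
  fixes a :: "real ^ 'n"
  assumes "flow_generated_by (constant_field a) \<phi>"
  shows "\<phi> t p = p + torus_proj (t *\<^sub>R a)"
proof -
  \<comment> \<open>\<open>G\<close> picks lifts pointwise without any continuity. Its integer jumps
    are invisible to \<open>cis (2 * pi * _)\<close>.\<close>
  obtain G where G: "\<And>s. torus_proj (G s) = \<phi> s p - torus_proj (s *\<^sub>R a)"
  proof -
    have "\<exists>g. torus_proj g = \<phi> s p - torus_proj (s *\<^sub>R a)" for s
      by (rule torus_proj_surj[of "\<phi> s p - torus_proj (s *\<^sub>R a)"]) blast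
    then show thesis using that by metis
  qed
  have "\<phi> t p - torus_proj (t *\<^sub>R a) = p"
  proof -
    have const: "cis (2 * pi * G t $ i) = cis (2 * pi * G 0 $ i)" for i
    proof -
      have "((\<lambda>s. cis (2 * pi * G s $ i)) has_derivative (\<lambda>_. 0)) (at s)" for s
      proof -
        obtain \<gamma> where \<gamma>: "\<forall>\<^sub>F r in nhds s. \<phi> r p = torus_proj (\<gamma> r)"
            "(\<gamma> has_vector_derivative a) (at s)"
        proof -
          have "has_velocity (\<lambda>s. \<phi> s p) s (\<phi> s p, a)"
            using assms unfolding flow_generated_by_def constant_field_def by blast
          then show thesis using that unfolding has_velocity_def by auto
        qed
        \<comment> \<open>Near \<open>s\<close> this is a differentiable lift of the same torus
          points that \<open>G\<close> lifts.\<close>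
        define \<delta> where "\<delta> r = \<gamma> r - r *\<^sub>R a" for r
        have "(\<delta> has_vector_derivative 0) (at s)"
          unfolding \<delta>_def using \<gamma>(2) by (auto intro!: derivative_eq_intros)
        then have "(\<delta> has_derivative (\<lambda>_. 0)) (at s)" by (simp add: has_vector_derivative_def)
        then have "((\<lambda>r. \<delta> r $ i) has_derivative (\<lambda>_. 0)) (at s)"
          using bounded_linear.has_derivative[OF bounded_linear_vec_nth, of \<delta> "\<lambda>_. 0" "at s" i] by simp
        then have "((\<lambda>r. \<delta> r $ i) has_real_derivative 0) (at s)"
          by (simp add: has_field_derivative_def lambda_zero)
        then have "((\<lambda>r. cos (2 * pi * \<delta> r $ i)) has_real_derivative 0) (at s)"
            "((\<lambda>r. sin (2 * pi * \<delta> r $ i)) has_real_derivative 0) (at s)"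
          by (auto intro!: derivative_eq_intros)
        then have "((\<lambda>r. Complex (cos (2 * pi * \<delta> r $ i)) (sin (2 * pi * \<delta> r $ i))) has_vector_derivative Complex 0 0) (at s)"
          unfolding has_real_derivative_iff_has_vector_derivative has_vector_derivative_complex_iff by simp
        then have D: "((\<lambda>r. cis (2 * pi * \<delta> r $ i)) has_derivative (\<lambda>_. 0)) (at s)"
          by (simp add: has_vector_derivative_def cis.code flip: zero_complex.code)
        have ev: "\<forall>\<^sub>F r in nhds s. cis (2 * pi * \<delta> r $ i) = cis (2 * pi * G r $ i)"
          using \<gamma>(1)
        proof eventually_elim
          case (elim r)
          then have "torus_proj (\<delta> r) = torus_proj (G r)"
            by (simp add: G \<delta>_def torus_proj_diff)
          then obtain k where "\<delta> r $ i = G r $ i + of_int k"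
            by (metis torus_proj_eq_iff Ints_cases diff_eq_eq add.commute)
          then show ?case
            by (simp add: distrib_left flip: cis_mult)
        qed
        show ?thesis
          by (rule has_derivative_transform_eventually[OF D])
            (use ev eventually_nhds_x_imp_x[OF ev] in \<open>auto simp: eventually_at_filter elim: eventually_mono\<close>)
      qed
      then show ?thesis
        using has_derivative_zero_unique[of UNIV "\<lambda>s. cis (2 * pi * G s $ i)" t 0]
        by (simp add: has_derivative_at_withinI)
    qed
    have "G t $ i - G 0 $ i \<in> \<int>" for i
    proof -
      have "cis (2 * pi * (G t $ i - G 0 $ i)) = 1"
        using const[of i] by (simp add: right_diff_distrib flip: cis_divide)
      then have "cos (2 * pi * (G t $ i - G 0 $ i)) = 1"
        by (metis cis.sel(1) one_complex.sel(1))
      then obtain k where "2 * pi * (G t $ i - G 0 $ i) = of_int k * 2 * pi"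
        using cos_one_2pi_int by blast
      then show ?thesis by simp
    qed
    then have "torus_proj (G t) = torus_proj (G 0)" by (simp add: torus_proj_eq_iff)
    then show ?thesis
      using assms by (simp add: G torus_proj_0 flow_generated_by_def)
  qed
  then show ?thesis by (metis diff_add_cancel)
qed

subsection \<open>The generalized symmetries of an irrational flow\<close>

text \<open>These turn out to be exactly the linear parts of the generalized symmetries.\<close>

definition eigenmats :: "real ^ 'n \<Rightarrow> (int ^ 'n ^ 'n) set" where
  "eigenmats a = {B. invertible B \<and> (\<exists>\<alpha>. real_mat B *v a = \<alpha> *\<^sub>R a)}"

lemma eigenmatsE:
  assumes "B \<in> eigenmats a" "a \<noteq> 0"
  obtains A \<alpha> where "invertible B" "B ** A = mat 1" "A ** B = mat 1" "\<alpha> \<noteq> 0"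
    "real_mat B *v a = \<alpha> *\<^sub>R a" "real_mat A *v a = inverse \<alpha> *\<^sub>R a"
proof -
  obtain A \<alpha> where B: "invertible B" "B ** A = mat 1" "A ** B = mat 1" "real_mat B *v a = \<alpha> *\<^sub>R a"
    using assms(1) unfolding eigenmats_def invertible_def by blast
  have "real_mat A *v (real_mat B *v a) = a"
    by (simp add: matrix_vector_mul_assoc B(3) real_mat_1 flip: real_mat_mult)
  then have A: "\<alpha> *\<^sub>R (real_mat A *v a) = a"
    by (simp add: B(4) matrix_vector_mult_scaleR)
  then have "\<alpha> \<noteq> 0" using assms(2) by auto
  moreover from this have "real_mat A *v a = inverse \<alpha> *\<^sub>R a"
    by (subst (2) A[symmetric]) simp
  ultimately show thesis using that B by blast
qed

text \<open>Eliminating \<open>s\<close> from coordinates \<open>i\<close> and \<open>j\<close>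
  shows that \<open>t\<close> times the minor \<open>?D\<close> is an integer combination of
  \<open>a $ i\<close> and \<open>a $ j\<close>. If the minor were nonzero, every real would be such
  a combination, but these are countable. Hence all minors vanish.\<close>

lemma parallel_if_line_mod_lattice:
  fixes a v :: "real ^ 'n"
  assumes "\<And>i. a $ i \<noteq> 0"
    and "\<And>t. \<exists>s. torus_proj (t *\<^sub>R v) = torus_proj (s *\<^sub>R a)"
  shows "\<exists>\<alpha>. v = \<alpha> *\<^sub>R a"
proof -
  fix i :: 'n
  have "v $ j * a $ i - v $ i * a $ j = 0" for j
  proof (rule ccontr)
    let ?D = "v $ j * a $ i - v $ i * a $ j"
    assume D: "?D \<noteq> 0"
    let ?C = "(\<lambda>(m, k). of_int m * a $ i - of_int k * a $ j) ` (UNIV :: (int \<times> int) set)"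
    have "r \<in> ?C" for r
    proof -
      obtain s where "torus_proj ((r / ?D) *\<^sub>R v) = torus_proj (s *\<^sub>R a)"
        using assms(2) by blast
      then have "\<forall>l. (r / ?D) * v $ l - s * a $ l \<in> \<int>"
        by (simp add: torus_proj_eq_iff)
      then obtain m k where mk: "(r / ?D) * v $ j - s * a $ j = of_int m"
          "(r / ?D) * v $ i - s * a $ i = of_int k"
        by (meson Ints_cases)
      have "of_int m * a $ i - of_int k * a $ j = (r / ?D) * ?D"
        unfolding mk[symmetric] by (simp only: algebra_simps)
      also have "\<dots> = r" using D by (simp only: nonzero_eq_divide_eq times_divide_eq_left) simp
      finally show ?thesis by (intro image_eqI[of _ _ "(m, k)"]) auto
    qed
    then have "?C = UNIV" by blast
    moreover have "countable ?C" by (intro countable_image) simp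
    ultimately show False using uncountable_UNIV_real by metis
  qed
  then have "v = (v $ i / a $ i) *\<^sub>R a"
    using assms(1)[of i] by (simp add: vec_eq_iff field_simps)
  then show ?thesis by blast
qed

section \<open>The normalizer in terms of conjugation\<close>

lemma conj_by_diffeo:
  assumes "torus_diffeo R"
  shows "R <#\<^bsub>Diff_torus\<^esub> H #>\<^bsub>Diff_torus\<^esub> inv\<^bsub>Diff_torus\<^esub> R = (\<lambda>f. R \<circ> f \<circ> inv_into UNIV R) ` H"
proof -
  have R: "bij R" "torus_diffeo (inv_into UNIV R)"
    using assms by (auto simp: torus_diffeo_def bij_imp_bij_inv inv_inv_eq)
  have "inv\<^bsub>Diff_torus\<^esub> R = inv_into UNIV R"
    unfolding m_inv_def
  proof (rule the_equality)
    show "inv_into UNIV R \<in> carrier Diff_torus \<and> R \<otimes>\<^bsub>Diff_torus\<^esub> inv_into UNIV R = \<one>\<^bsub>Diff_torus\<^esub> \<and>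
        inv_into UNIV R \<otimes>\<^bsub>Diff_torus\<^esub> R = \<one>\<^bsub>Diff_torus\<^esub>"
      using R by (simp add: Diff_torus_def bij_is_inj bij_is_surj flip: surj_iff inj_iff)
  next
    fix S
    assume "S \<in> carrier Diff_torus \<and> R \<otimes>\<^bsub>Diff_torus\<^esub> S = \<one>\<^bsub>Diff_torus\<^esub> \<and>
        S \<otimes>\<^bsub>Diff_torus\<^esub> R = \<one>\<^bsub>Diff_torus\<^esub>"
    then show "S = inv_into UNIV R" by (simp add: Diff_torus_def inv_unique_comp[of R S])
  qed
  then show ?thesis
    by (auto simp: l_coset_def r_coset_def Diff_torus_def)
qed

text \<open>The action behind \<open>normalizer\<close> is restricted to subsets of the carrier; the
  hypothesis places \<open>range \<phi>\<close> among them.\<close>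

lemma gen_symmetry_iff:
  assumes "range \<phi> \<subseteq> {R. torus_diffeo R}"
  shows "R \<in> gen_symmetry \<phi> \<longleftrightarrow>
    torus_diffeo R \<and> (\<lambda>f. R \<circ> f \<circ> inv_into UNIV R) ` range \<phi> = range \<phi>"
  using assms conj_by_diffeo[of R "range \<phi>"]
  by (auto simp: gen_symmetry_def normalizer_def stabilizer_def Diff_torus_def)

text \<open>Conjugation by an affine map rescales time by the eigenvalue, which gives one inclusion.
  For the other, linearity is established both for the normalized symmetry and for its inverse, so
  that the inverse matrix is integral too.\<close>

lemma gen_symmetry_constant_field:
  fixes a :: "real ^ 'n"
  assumes a: "independent_over_rat a" and \<phi>: "flow_generated_by (constant_field a) \<phi>"
  shows "gen_symmetry \<phi> = {torus_affine B c | B c. B \<in> eigenmats a}"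
proof -
  have flow: "\<phi> t = torus_affine (mat 1) (torus_proj (t *\<^sub>R a))" for t
    using flow_constant_field[OF \<phi>] by (auto simp: torus_affine_def)
  have "invertible (mat 1 :: int ^ 'n ^ 'n)"
    unfolding invertible_def using matrix_mul_lid by blast
  then have "range \<phi> \<subseteq> {R. torus_diffeo R}"
    by (auto simp: flow torus_diffeo_affine)
  note iff = gen_symmetry_iff[OF this]
  show ?thesis
  proof (intro equalityI subsetI)
    fix R assume "R \<in> {torus_affine B c | B c. B \<in> eigenmats a}"
    then obtain B c where R: "R = torus_affine B c" and B_in: "B \<in> eigenmats a" by blast
    have "a \<noteq> 0" using independent_over_rat_nonzero[OF a] by auto
    from B_in this obtain A \<alpha> where B: "invertible B" "real_mat B *v a = \<alpha> *\<^sub>R a"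
      and A: "B ** A = mat 1" "A ** B = mat 1" and "\<alpha> \<noteq> 0"
      by (rule eigenmatsE) blast
    note inv = torus_affine_inverse[OF A, of c]
    have bij: "bij R" unfolding R using inv by (rule o_bij[rotated])
    have conj: "R \<circ> \<phi> t \<circ> inv_into UNIV R = \<phi> (\<alpha> * t)" for t
    proof -
      have "R \<circ> \<phi> t = \<phi> (\<alpha> * t) \<circ> R"
        by (simp add: R flow torus_affine_comp torus_lin_proj matrix_vector_mult_scaleR B(2) add.commute
            mult.commute)
      then have "R \<circ> \<phi> t \<circ> inv_into UNIV R = \<phi> (\<alpha> * t) \<circ> (R \<circ> inv_into UNIV R)"
        by (simp add: comp_assoc)
      also have "R \<circ> inv_into UNIV R = id" using bij by (simp add: bij_is_surj flip: surj_iff)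
      finally show ?thesis by (simp add: o_def)
    qed
    \<comment> \<open>Equality of the sets, and not just inclusion, comes from rescaling time by the
      inverse of \<alpha>.\<close>
    have "\<phi> t \<in> (\<lambda>f. R \<circ> f \<circ> inv_into UNIV R) ` range \<phi>" for t
      using conj[of "t / \<alpha>"] \<open>\<alpha> \<noteq> 0\<close> by (auto intro!: image_eqI[of _ _ "\<phi> (t / \<alpha>)"])
    then show "R \<in> gen_symmetry \<phi>"
      using conj torus_diffeo_affine[OF B(1), of c] R unfolding iff by auto
  next
    fix R assume "R \<in> gen_symmetry \<phi>"
    then have R: "torus_diffeo R" "(\<lambda>f. R \<circ> f \<circ> inv_into UNIV R) ` range \<phi> = range \<phi>"
      unfolding iff by auto
    then have bij: "bij R" by (simp add: torus_diffeo_def)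
    \<comment> \<open>One \<open>s\<close> serves all \<open>p\<close>; comparing a general
      \<open>p\<close> with 0 then yields additivity along the orbit.\<close>
    have ex: "\<exists>s. \<forall>p. R (p + torus_proj (t *\<^sub>R a)) = R p + torus_proj (s *\<^sub>R a)" for t
    proof -
      have "R \<circ> \<phi> t \<circ> inv_into UNIV R \<in> range \<phi>" using R(2) by blast
      then obtain s where s: "R \<circ> \<phi> t \<circ> inv_into UNIV R = \<phi> s" by blast
      have "R (\<phi> t p) = \<phi> s (R p)" for p
        using fun_cong[OF s, of "R p"] bij by (simp add: bij_is_inj)
      then show ?thesis by (auto simp: flow torus_affine_def)
    qed
    define h where "h = (\<lambda>p. R (p + 0) + - R 0)" \<comment> \<open>spelled so as to match \<open>torus_differentiable_translate\<close>\<close>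
    have hd: "torus_differentiable h"
      unfolding h_def using R(1) by (intro torus_differentiable_translate torus_smooth_imp_differentiable)
        (simp add: torus_diffeo_def)
    have h_line: "\<exists>s. h (torus_proj (t *\<^sub>R a)) = torus_proj (s *\<^sub>R a)" for t
    proof -
      obtain s where "R (0 + torus_proj (t *\<^sub>R a)) = R 0 + torus_proj (s *\<^sub>R a)" using ex by blast
      then have "h (torus_proj (t *\<^sub>R a)) = torus_proj (s *\<^sub>R a)" by (simp add: h_def)
      then show ?thesis by blast
    qed
    have "h (p + torus_proj (t *\<^sub>R a)) = h p + h (torus_proj (t *\<^sub>R a))" for p t
    proof -
      obtain s where s: "\<And>p. R (p + torus_proj (t *\<^sub>R a)) = R p + torus_proj (s *\<^sub>R a)" using ex by blast
      show ?thesis using s[of p] s[of 0] by (simp add: h_def)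
    qed
    then have add: "h (p + q) = h p + h q" for p q
      using additive_if_additive_on_line[OF a hd] by blast
    obtain B where B: "h = torus_lin B"
      using additive_differentiable_imp_torus_lin[OF hd add] by blast
    \<comment> \<open>The inverse of \<open>h\<close>, again written with a trailing summand to fit
      \<open>torus_differentiable_translate\<close>.\<close>
    define g where "g = (\<lambda>p. inv_into UNIV R (p + R 0) + 0)"
    have gd: "torus_differentiable g"
      unfolding g_def using R(1) by (intro torus_differentiable_translate torus_smooth_imp_differentiable)
        (simp add: torus_diffeo_def)
    have hg: "h (g p) = p" and gh: "g (h p) = p" for p
      using bij by (simp_all add: h_def g_def bij_is_inj bij_is_surj surj_f_inv_f)
    have "g (p + q) = g p + g q" for p q by (metis add gh hg)
    then obtain A where A: "g = torus_lin A"
      using additive_differentiable_imp_torus_lin[OF gd] by blast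
    have "B ** A = mat 1" "A ** B = mat 1"
      using hg gh unfolding A B by (auto intro!: torus_lin_inject simp: torus_lin_mult)
    then have "invertible B" by (auto simp: invertible_def)
    moreover have "\<exists>\<alpha>. real_mat B *v a = \<alpha> *\<^sub>R a"
    proof (rule parallel_if_line_mod_lattice)
      fix t
      show "\<exists>s. torus_proj (t *\<^sub>R (real_mat B *v a)) = torus_proj (s *\<^sub>R a)"
        using h_line[of t] by (simp add: B torus_lin_proj matrix_vector_mult_scaleR)
    qed (rule independent_over_rat_nonzero[OF a])
    moreover have "R = torus_affine B (R 0)"
      unfolding torus_affine_def B[symmetric] h_def by simp
    ultimately show "R \<in> {torus_affine B c | B c. B \<in> eigenmats a}"
      unfolding eigenmats_def by blast
  qed
qed

text \<open>The pushforward of the constant field has the constant coefficient vector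
  \<open>real_mat B *v a\<close>, and the scalar is unique because \<open>a\<close> is
  nonzero.\<close>

lemma multiplier_torus_affine:
  assumes "B \<in> eigenmats a" "real_mat B *v a = \<alpha> *\<^sub>R a" "a \<noteq> 0"
  shows "multiplier (constant_field a) (torus_affine B c) = \<alpha>"
proof -
  obtain A \<beta> where A: "B ** A = mat 1" "A ** B = mat 1" and \<beta>: "\<beta> \<noteq> 0" "real_mat B *v a = \<beta> *\<^sub>R a"
    using assms(1,3) by (rule eigenmatsE) blast
  then have "\<alpha> \<noteq> 0" using assms(2,3) by auto
  have "bij (torus_affine B c)" using torus_affine_inverse[OF A, of c] by (rule o_bij[rotated])
  then have "torus_affine B c (inv_into UNIV (torus_affine B c) q) = q" for q
    by (simp add: bij_is_surj surj_f_inv_f)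
  then have "pushforward (torus_affine B c) (constant_field a) = constant_field (\<alpha> *\<^sub>R a)"
    by (simp add: pushforward_def tangent_map_def constant_field_def torus_derivative_affine
        fun_eq_iff assms(2))
  then show ?thesis
    unfolding multiplier_def
    using \<open>\<alpha> \<noteq> 0\<close> assms(3) by (intro the_equality) (auto simp: constant_field_def scale_field_def fun_eq_iff)
qed

subsection \<open>The characteristic polynomial of an integer matrix\<close>

text \<open>The matrix zI - B over the integer polynomials; its determinant is the characteristic
  polynomial of \<open>B\<close>.\<close>

definition charpoly_mat :: "int ^ 'n ^ 'n \<Rightarrow> int poly ^ 'n ^ 'n" where
  "charpoly_mat B = (\<chi> i j. if i = j then [:- (B $ i $ j), 1:] else [:- (B $ i $ j):])"

text \<open>In the Leibniz expansion the term of a permutation has degree at most its number of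
  fixed points. Only the identity reaches the full degree, with a product of monic linear
  factors.\<close>

lemma degree_det_charpoly_mat:
  fixes B :: "int ^ 'n ^ 'n"
  shows "degree (det (charpoly_mat B)) = CARD('n)" and "lead_coeff (det (charpoly_mat B)) = 1"
proof -
  let ?C = "charpoly_mat B"
  let ?term = "\<lambda>p. of_int (sign p) * (\<Prod>i\<in>UNIV. ?C $ i $ p i)"
  have deg: "degree (?term p) \<le> card {i. p i = i}" for p :: "'n \<Rightarrow> 'n"
  proof -
    have "degree (?term p) \<le> degree (\<Prod>i\<in>UNIV. ?C $ i $ p i)"
      using degree_mult_le[of "of_int (sign p)" "\<Prod>i\<in>UNIV. ?C $ i $ p i"] by simp
    also have "\<dots> \<le> (\<Sum>i\<in>UNIV. degree (?C $ i $ p i))"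
      using degree_prod_sum_le[of UNIV "\<lambda>i. ?C $ i $ p i"] by (simp add: o_def)
    also have "\<dots> \<le> (\<Sum>i\<in>UNIV. of_bool (p i = i))"
      by (intro sum_mono) (auto simp: charpoly_mat_def)
    also have "\<dots> = card {i. p i = i}" by (simp add: of_bool_def sum.If_cases)
    finally show ?thesis .
  qed
  have diag: "lead_coeff (\<Prod>i\<in>UNIV. ?C $ i $ i) = 1" "degree (\<Prod>i\<in>UNIV. ?C $ i $ i) = CARD('n)"
  proof -
    show "lead_coeff (\<Prod>i\<in>UNIV. ?C $ i $ i) = 1"
      by (simp add: lead_coeff_prod charpoly_mat_def)
    have "degree (\<Prod>i\<in>UNIV. ?C $ i $ i) = (\<Sum>i\<in>UNIV. degree (?C $ i $ i))"
      by (rule degree_prod_eq_sum_degree) (simp add: charpoly_mat_def)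
    then show "degree (\<Prod>i\<in>UNIV. ?C $ i $ i) = CARD('n)" by (simp add: charpoly_mat_def)
  qed
  have "coeff (det ?C) (CARD('n)) = (\<Sum>p | p permutes (UNIV :: 'n set). coeff (?term p) (CARD('n)))"
    by (simp add: det_def coeff_sum)
  also have "\<dots> = (\<Sum>p\<in>{id}. coeff (?term p) (CARD('n)))"
  proof (rule sum.mono_neutral_right)
    show "\<forall>p\<in>{p. p permutes UNIV} - {id}. coeff (?term p) (CARD('n)) = 0"
    proof
      fix p :: "'n \<Rightarrow> 'n" assume "p \<in> {p. p permutes UNIV} - {id}"
      then have "{i. p i = i} \<subset> UNIV" by (auto simp: fun_eq_iff)
      then have "card {i. p i = i} < CARD('n)" by (intro psubset_card_mono) auto
      then show "coeff (?term p) (CARD('n)) = 0"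
        using deg[of p] by (intro coeff_eq_0) simp
    qed
  qed (auto simp: permutes_id)
  also have "\<dots> = 1" using diag by simp
  finally have coeff: "coeff (det ?C) (CARD('n)) = 1" .
  have "degree (det ?C) \<le> CARD('n)"
    unfolding det_def
    by (intro degree_sum_le order_trans[OF deg] card_mono) auto
  then show "degree (det ?C) = CARD('n)" using coeff by (simp add: le_antisym le_degree)
  then show "lead_coeff (det ?C) = 1" using coeff by simp
qed

section \<open>Evaluating the characteristic polynomial at an eigenvalue\<close>

lemma map_poly_of_int_add:
  "map_poly of_int (p + q) = map_poly of_int p + (map_poly of_int q :: 'a::comm_ring_1 poly)"
  by (simp add: poly_eq_iff coeff_map_poly)

lemma map_poly_of_int_mult:
  "map_poly of_int (p * q) = map_poly of_int p * (map_poly of_int q :: 'a::comm_ring_1 poly)"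
  by (simp add: poly_eq_iff coeff_map_poly coeff_mult)

text \<open>Evaluation at \<open>x\<close> is a ring homomorphism, and the Leibniz formula uses only
  sums, products and signs.\<close>

lemma poly_of_int_det:
  fixes x :: "'a::comm_ring_1" and C :: "int poly ^ 'n ^ 'n"
  shows "poly (map_poly of_int (det C)) x = det (\<chi> i j. poly (map_poly of_int (C $ i $ j)) x)"
proof -
  define h where "h p = poly (map_poly of_int p) x" for p
  have add: "h (p + q) = h p + h q" for p q
    by (simp add: h_def map_poly_of_int_add)
  have mult: "h (p * q) = h p * h q" for p q
    by (simp add: h_def map_poly_of_int_mult)
  have h_sum: "h (sum f S) = (\<Sum>s\<in>S. h (f s))" for f :: "('n \<Rightarrow> 'n) \<Rightarrow> int poly" and S
    by (induction S rule: infinite_finite_induct) (simp_all add: add, simp_all add: h_def)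
  have h_prod: "h (prod f S) = (\<Prod>s\<in>S. h (f s))" for f :: "'n \<Rightarrow> int poly" and S
    by (induction S rule: infinite_finite_induct) (simp_all add: mult, simp_all add: h_def map_poly_1)
  have "h (of_int (sign p)) = of_int (sign p)" for p :: "'n \<Rightarrow> 'n"
    by (simp add: h_def of_int_poly map_poly_pCons)
  then show ?thesis
    unfolding det_def h_def[symmetric] by (simp add: h_sum mult h_prod)
qed

text \<open>At \<alpha> the characteristic matrix becomes \<alpha>I - B, which kills the nonzero
  vector \<open>a\<close> and so has determinant 0. The characteristic polynomial is therefore a
  monic witness for both claims.\<close>

lemma eigenvalue_algebraic_int:
  fixes B :: "int ^ 'n ^ 'n"
  assumes "real_mat B *v a = \<alpha> *\<^sub>R a" "a \<noteq> 0"
  shows "algebraic_int \<alpha>" and "algebraic_int_degree \<alpha> \<le> CARD('n)"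
proof -
  let ?p = "det (charpoly_mat B)"
  let ?M = "\<chi> i j. poly (map_poly of_int (charpoly_mat B $ i $ j)) \<alpha>"
  have M: "?M = mat \<alpha> - real_mat B"
    by (simp add: vec_eq_iff charpoly_mat_def mat_def map_poly_pCons)
  have "mat \<alpha> *v a = \<alpha> *\<^sub>R a"
    by (simp add: vec_eq_iff matrix_vector_mult_def mat_def if_distrib[of "\<lambda>x. x * _"] cong: if_cong)
  then have "?M *v a = 0" by (simp add: M matrix_vector_mult_diff_rdistrib assms(1))
  then have "\<not> invertible ?M"
    using assms(2) matrix_left_invertible_ker[of ?M] unfolding invertible_def by blast
  then have "det ?M = 0" by (simp add: invertible_det_nz)
  then have root: "poly (map_poly of_int ?p) \<alpha> = 0" by (simp add: poly_of_int_det)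
  note deg = degree_det_charpoly_mat[of B]
  show "algebraic_int \<alpha>"
    unfolding algebraic_int_altdef_ipoly using root deg by blast
  show "algebraic_int_degree \<alpha> \<le> CARD('n)"
    unfolding algebraic_int_degree_def using root deg by (intro Least_le) blast
qed

subsection \<open>The group of eigenmatrices\<close>

lemma comm_group_real_units: "comm_group real_units"
proof (rule comm_groupI)
  fix x assume "x \<in> carrier real_units"
  then show "\<exists>y\<in>carrier real_units. y \<otimes>\<^bsub>real_units\<^esub> x = \<one>\<^bsub>real_units\<^esub>"
    by (intro bexI[of _ "inverse x"]) (auto simp: real_units_def)
qed (auto simp: real_units_def)

lemma group_GL_int: "group (GL_int :: (int ^ 'n ^ 'n) monoid)"
proof (rule groupI)
  fix A B :: "int ^ 'n ^ 'n"
  assume "A \<in> carrier GL_int" "B \<in> carrier GL_int"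
  then show "A \<otimes>\<^bsub>GL_int\<^esub> B \<in> carrier GL_int"
    by (auto simp: GL_int_def intro: invertible_mult)
next
  fix A :: "int ^ 'n ^ 'n" assume "A \<in> carrier GL_int"
  then obtain B where "A ** B = mat 1" "B ** A = mat 1" by (auto simp: GL_int_def invertible_def)
  then show "\<exists>B\<in>carrier GL_int. B \<otimes>\<^bsub>GL_int\<^esub> A = \<one>\<^bsub>GL_int\<^esub>"
    by (intro bexI[of _ B]) (auto simp: GL_int_def invertible_def)
qed (auto simp: GL_int_def invertible_def matrix_mul_assoc intro: exI[of _ "mat 1"])

definition eigenval :: "real ^ 'n \<Rightarrow> int ^ 'n ^ 'n \<Rightarrow> real" where
  "eigenval a B = (THE \<alpha>. real_mat B *v a = \<alpha> *\<^sub>R a)"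

lemma eigenval_eq:
  assumes "real_mat B *v a = \<alpha> *\<^sub>R a" "a \<noteq> 0"
  shows "eigenval a B = \<alpha>"
  unfolding eigenval_def using assms by (intro the_equality) auto

lemma eigenval_eigenvector:
  assumes "B \<in> eigenmats a" "a \<noteq> 0"
  shows "real_mat B *v a = eigenval a B *\<^sub>R a" "eigenval a B \<noteq> 0"
  using eigenmatsE[OF assms] eigenval_eq[OF _ assms(2)] by metis+

lemma eigenmats_mult:
  assumes "A \<in> eigenmats a" "B \<in> eigenmats a" "a \<noteq> 0"
  shows "A ** B \<in> eigenmats a" "eigenval a (A ** B) = eigenval a A * eigenval a B"
proof -
  have *: "real_mat (A ** B) *v a = (eigenval a A * eigenval a B) *\<^sub>R a"
    using eigenval_eigenvector(1)[OF assms(1,3)] eigenval_eigenvector(1)[OF assms(2,3)]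
    by (simp add: real_mat_mult matrix_vector_mult_scaleR mult.commute flip: matrix_vector_mul_assoc)
  then show "eigenval a (A ** B) = eigenval a A * eigenval a B"
    by (rule eigenval_eq) (rule assms(3))
  show "A ** B \<in> eigenmats a"
    using * assms(1,2) unfolding eigenmats_def by (auto intro: invertible_mult)
qed

lemma eigenmats_one:
  assumes "a \<noteq> 0"
  shows "mat 1 \<in> eigenmats a" "eigenval a (mat 1) = 1"
proof -
  have *: "real_mat (mat 1) *v a = 1 *\<^sub>R a" by (simp add: real_mat_1)
  then show "eigenval a (mat 1) = 1" using assms by (rule eigenval_eq)
  show "mat 1 \<in> eigenmats a"
    using * unfolding eigenmats_def invertible_def by (metis (mono_tags, lifting) matrix_mul_lid mem_Collect_eq)
qed

lemma eigenmats_inverse: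
  assumes "B \<in> eigenmats a" "a \<noteq> 0"
  obtains A where "A \<in> eigenmats a" "B ** A = mat 1" "A ** B = mat 1"
    "eigenval a A = inverse (eigenval a B)"
proof -
  obtain A \<alpha> where A: "B ** A = mat 1" "A ** B = mat 1"
      "real_mat B *v a = \<alpha> *\<^sub>R a" "real_mat A *v a = inverse \<alpha> *\<^sub>R a"
    using assms by (rule eigenmatsE) blast
  moreover have "A \<in> eigenmats a"
    using A unfolding eigenmats_def invertible_def by blast
  moreover have "eigenval a A = inverse (eigenval a B)"
    using eigenval_eq[OF A(3)] eigenval_eq[OF A(4)] assms(2) by simp
  ultimately show thesis using that by blast
qed

text \<open>If the eigenvalues agree, the difference of the matrices kills \<open>a\<close>; each of
  its rows is then an integer relation among the coordinates of \<open>a\<close>, hence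
  zero.\<close>

lemma inj_on_eigenval:
  assumes "independent_over_rat a"
  shows "inj_on (eigenval a) (eigenmats a)"
proof (rule inj_onI)
  fix A B assume *: "A \<in> eigenmats a" "B \<in> eigenmats a" "eigenval a A = eigenval a B"
  have "a \<noteq> 0" using independent_over_rat_nonzero[OF assms] by auto
  then have "real_mat A *v a = real_mat B *v a"
    using * eigenval_eigenvector(1) by metis
  then have "(\<Sum>j\<in>UNIV. of_int (A $ i $ j - B $ i $ j) * a $ j) = 0" for i
    by (simp add: vec_eq_iff matrix_vector_mult_def left_diff_distrib sum_subtractf)
  then have "A $ i $ j - B $ i $ j = 0" for i j
    using assms[unfolded independent_over_rat_def, rule_format, of "\<lambda>j. A $ i $ j - B $ i $ j"] by blast
  then show "A = B" by (simp add: vec_eq_iff)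
qed

subsection \<open>The semidirect product decomposition\<close>

locale irrational_flow_subgroup =
  fixes a :: "real ^ 'n" and \<phi> :: "real \<Rightarrow> 'n torus \<Rightarrow> 'n torus" and \<Lambda> :: "real set"
  assumes indep: "independent_over_rat a"
    and flow: "flow_generated_by (constant_field a) \<phi>"
    and sub: "subgroup \<Lambda> (multiplier_group (constant_field a) \<phi>)"
begin

lemma a_nz: "a \<noteq> 0"
  using independent_over_rat_nonzero[OF indep] by auto

text \<open>The linear parts of the symmetries whose multiplier lies in
  \<open>\<Lambda>\<close>.\<close>

definition mats :: "(int ^ 'n ^ 'n) set" where
  "mats = {B \<in> eigenmats a. eigenval a B \<in> \<Lambda>}"

lemma multiplier_affine:
  "B \<in> eigenmats a \<Longrightarrow> multiplier (constant_field a) (torus_affine B c) = eigenval a B"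
  by (rule multiplier_torus_affine[OF _ eigenval_eigenvector(1)[OF _ a_nz] a_nz])

lemma multiplier_image:
  "multiplier (constant_field a) ` gen_symmetry \<phi> = eigenval a ` eigenmats a"
  unfolding gen_symmetry_constant_field[OF indep flow]
  by (force simp: multiplier_affine image_iff)

text \<open>The assumption places \<open>\<Lambda>\<close> inside the multiplier group. That group
  is the set of eigenvalues of \<open>eigenmats a\<close>, which is itself a subgroup of
  \<open>real_units\<close>, and subgroups compose.\<close>

lemma subgroup_Lambda: "subgroup \<Lambda> real_units"
proof -
  interpret comm_group real_units by (rule comm_group_real_units)
  have "subgroup (eigenval a ` eigenmats a) real_units"
  proof (rule subgroupI)
    fix x assume x: "x \<in> eigenval a ` eigenmats a"
    then obtain B where B: "B \<in> eigenmats a" "x = eigenval a B" by blast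
    obtain A where "A \<in> eigenmats a" "eigenval a A = inverse x"
      using eigenmats_inverse[OF B(1) a_nz] B(2) by metis
    moreover have "inv\<^bsub>real_units\<^esub> x = inverse x"
      using eigenval_eigenvector(2)[OF B(1) a_nz] B(2) by (intro inv_equality) (auto simp: real_units_def)
    ultimately show "inv\<^bsub>real_units\<^esub> x \<in> eigenval a ` eigenmats a" by (metis imageI)
  next
    fix x y assume "x \<in> eigenval a ` eigenmats a" "y \<in> eigenval a ` eigenmats a"
    then obtain A B where "A \<in> eigenmats a" "B \<in> eigenmats a" "x = eigenval a A" "y = eigenval a B"
      by blast
    then have "x * y = eigenval a (A ** B)" "A ** B \<in> eigenmats a"
      using eigenmats_mult[OF _ _ a_nz] by auto
    then show "x \<otimes>\<^bsub>real_units\<^esub> y \<in> eigenval a ` eigenmats a"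
      by (simp add: real_units_def)
  next
    show "eigenval a ` eigenmats a \<subseteq> carrier real_units"
      using eigenval_eigenvector(2)[OF _ a_nz] by (auto simp: real_units_def)
    show "eigenval a ` eigenmats a \<noteq> {}" using eigenmats_one[OF a_nz] by blast
  qed
  then show ?thesis
    using sub unfolding multiplier_group_def multiplier_image by (rule incl_subgroup)
qed

lemma Lambda_closed: "x \<in> \<Lambda> \<Longrightarrow> y \<in> \<Lambda> \<Longrightarrow> x * y \<in> \<Lambda>"
  and Lambda_one: "1 \<in> \<Lambda>"
  and Lambda_inverse: "x \<in> \<Lambda> \<Longrightarrow> inverse x \<in> \<Lambda>"
proof -
  interpret comm_group real_units by (rule comm_group_real_units)
  interpret subgroup \<Lambda> real_units by (rule subgroup_Lambda)
  show "x \<in> \<Lambda> \<Longrightarrow> y \<in> \<Lambda> \<Longrightarrow> x * y \<in> \<Lambda>" using m_closed by (simp add: real_units_def)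
  show "1 \<in> \<Lambda>" using one_closed by (simp add: real_units_def)
  assume x: "x \<in> \<Lambda>"
  have "inv\<^bsub>real_units\<^esub> x = inverse x"
    using subset x by (intro inv_equality) (auto simp: real_units_def)
  then show "inverse x \<in> \<Lambda>" using m_inv_closed[OF x] by simp
qed

lemma mats_mult: "A \<in> mats \<Longrightarrow> B \<in> mats \<Longrightarrow> A ** B \<in> mats"
  by (auto simp: mats_def eigenmats_mult a_nz Lambda_closed)

lemma mats_one: "mat 1 \<in> mats"
  by (simp add: mats_def eigenmats_one a_nz Lambda_one)

lemma mats_inverse:
  assumes "B \<in> mats"
  obtains A where "A \<in> mats" "B ** A = mat 1" "A ** B = mat 1"
proof -
  have "B \<in> eigenmats a" using assms by (simp add: mats_def)
  then obtain A where "A \<in> eigenmats a" "B ** A = mat 1" "A ** B = mat 1"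
      "eigenval a A = inverse (eigenval a B)"
    using a_nz by (rule eigenmats_inverse)
  then show thesis using that[of A] assms by (simp add: mats_def Lambda_inverse)
qed

lemma bij_betw_eigenval: "bij_betw (eigenval a) mats \<Lambda>"
proof -
  have "\<Lambda> \<subseteq> eigenval a ` eigenmats a"
    using subgroup.subset[OF sub] by (simp add: multiplier_group_def multiplier_image)
  then have "eigenval a ` mats = \<Lambda>" by (auto simp: mats_def)
  moreover have "inj_on (eigenval a) mats"
    using inj_on_eigenval[OF indep] by (rule inj_on_subset) (auto simp: mats_def)
  ultimately show ?thesis by (simp add: bij_betw_def)
qed

lemma subgroup_mats: "subgroup mats GL_int"
proof -
  interpret group "GL_int :: (int ^ 'n ^ 'n) monoid" by (rule group_GL_int)
  show ?thesis
  proof (rule subgroupI)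
    show sub: "mats \<subseteq> carrier GL_int"
      by (auto simp: mats_def eigenmats_def GL_int_def)
    show "mats \<noteq> {}" using mats_one by blast
    fix A assume A: "A \<in> mats"
    then obtain B where B: "B \<in> mats" "A ** B = mat 1" "B ** A = mat 1" by (rule mats_inverse)
    then have "inv\<^bsub>GL_int\<^esub> A = B"
      using A sub by (intro inv_equality) (auto simp: GL_int_def)
    then show "inv\<^bsub>GL_int\<^esub> A \<in> mats" using B by simp
  next
    fix A B assume "A \<in> mats" "B \<in> mats"
    then show "A \<otimes>\<^bsub>GL_int\<^esub> B \<in> mats" by (simp add: GL_int_def mats_mult)
  qed
qed

text \<open>Both products have the same eigenvalue, since real numbers commute, and the eigenvalue
  determines the matrix.\<close>

lemma mats_commute:
  assumes "A \<in> mats" "B \<in> mats"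
  shows "A ** B = B ** A"
proof -
  have "eigenval a (A ** B) = eigenval a (B ** A)"
    using assms by (simp add: mats_def eigenmats_mult a_nz)
  then show ?thesis
    using assms mats_mult bij_betw_eigenval unfolding bij_betw_def inj_on_def by blast
qed

lemma eigenval_iso:
  "eigenval a \<in> iso (GL_int\<lparr>carrier := mats\<rparr>) (real_units\<lparr>carrier := \<Lambda>\<rparr>)"
  using bij_betw_eigenval
  by (auto simp: iso_def hom_def GL_int_def real_units_def eigenmats_mult a_nz mats_def)

section \<open>The preimage of \<open>\<Lambda>\<close> as a group of affine maps\<close>

abbreviation preim ::  "('n torus \<Rightarrow> 'n torus) monoid" where
  "preim \<equiv> multiplier_preimage (constant_field a) \<phi> \<Lambda>"

lemma carrier_preim: "carrier preim = {torus_affine B c | B c. B \<in> mats}"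
  unfolding multiplier_preimage_def gen_symmetry_constant_field[OF indep flow]
  by (auto simp: mats_def multiplier_affine)

lemma mult_preim [simp]: "f \<otimes>\<^bsub>preim\<^esub> g = f \<circ> g" and one_preim [simp]: "\<one>\<^bsub>preim\<^esub> = id"
  by (simp_all add: multiplier_preimage_def Diff_torus_def)

lemma group_preim: "group preim"
proof (rule groupI)
  fix f g assume "f \<in> carrier preim" "g \<in> carrier preim"
  then obtain A B c d where "f = torus_affine A c" "g = torus_affine B d" "A \<in> mats" "B \<in> mats"
    unfolding carrier_preim by blast
  then show "f \<otimes>\<^bsub>preim\<^esub> g \<in> carrier preim"
    unfolding carrier_preim using mats_mult by (auto simp: torus_affine_comp)
next
  show "\<one>\<^bsub>preim\<^esub> \<in> carrier preim"
    unfolding carrier_preim using mats_one by (auto simp flip: torus_affine_id)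
next
  fix f assume "f \<in> carrier preim"
  then obtain B c where f: "f = torus_affine B c" "B \<in> mats"
    unfolding carrier_preim by blast
  obtain A where A: "A \<in> mats" "B ** A = mat 1" "A ** B = mat 1"
    using f(2) by (rule mats_inverse)
  show "\<exists>g\<in>carrier preim. g \<otimes>\<^bsub>preim\<^esub> f = \<one>\<^bsub>preim\<^esub>"
  proof (rule bexI)
    show "torus_affine A (- torus_lin A c) \<otimes>\<^bsub>preim\<^esub> f = \<one>\<^bsub>preim\<^esub>"
      using torus_affine_inverse(2)[OF A(2,3)] by (simp add: f(1))
    show "torus_affine A (- torus_lin A c) \<in> carrier preim"
      unfolding carrier_preim using A(1) by blast
  qed
qed (auto simp: comp_assoc)

lemma multiplier_hom: "multiplier (constant_field a) \<in> hom preim real_units"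
proof (rule homI)
  fix f assume "f \<in> carrier preim"
  then show "multiplier (constant_field a) f \<in> carrier real_units"
    unfolding carrier_preim
    by (auto simp: mats_def multiplier_affine real_units_def eigenval_eigenvector a_nz)
next
  fix f g assume "f \<in> carrier preim" "g \<in> carrier preim"
  then obtain A B c d where "f = torus_affine A c" "g = torus_affine B d" "A \<in> mats" "B \<in> mats"
    unfolding carrier_preim by blast
  then show "multiplier (constant_field a) (f \<otimes>\<^bsub>preim\<^esub> g) =
      multiplier (constant_field a) f \<otimes>\<^bsub>real_units\<^esub> multiplier (constant_field a) g"
    by (simp add: torus_affine_comp multiplier_affine eigenmats_mult a_nz mats_def real_units_def)
qed

definition translation_maps :: "('n torus \<Rightarrow> 'n torus) set" where
  "translation_maps = range (torus_affine (mat 1))"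

definition linear_maps :: "('n torus \<Rightarrow> 'n torus) set" where
  "linear_maps = (\<lambda>B. torus_affine B 0) ` mats"

text \<open>Multiplier 1 forces the linear part to be the identity, because the eigenvalue
  determines the matrix. Normality of the translations follows from this description.\<close>

lemma translations_eq_kernel: "translation_maps = kernel preim real_units (multiplier (constant_field a))"
proof -
  have "eigenval a B = 1 \<longleftrightarrow> B = mat 1" if "B \<in> mats" for B
    using that mats_one bij_betw_eigenval eigenmats_one(2)[OF a_nz]
    unfolding bij_betw_def inj_on_def by metis
  then show ?thesis
    using mats_one unfolding kernel_def carrier_preim translation_maps_def
    by (auto simp: real_units_def multiplier_affine mats_def)
qed

lemma normal_translation_maps: "translation_maps \<lhd> preim"
proof -
  interpret group_hom preim real_units "multiplier (constant_field a)"
    using group_preim comm_group_real_units multiplier_hom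
    by (simp add: group_hom_def group_hom_axioms_def comm_group_def)
  show ?thesis unfolding translations_eq_kernel by (rule normal_kernel)
qed

lemma linear_maps_iso:
  "(\<lambda>B. torus_affine B 0) \<in> iso (GL_int\<lparr>carrier := mats\<rparr>) (preim\<lparr>carrier := linear_maps\<rparr>)"
  by (auto simp: iso_def hom_def bij_betw_def inj_on_def GL_int_def linear_maps_def
      torus_affine_comp torus_affine_eq_iff)

lemma translations_iso:
  "torus_affine (mat 1) \<in> iso torus_group (preim\<lparr>carrier := translation_maps\<rparr>)"
  by (auto simp: iso_def hom_def bij_betw_def inj_on_def torus_group_def translation_maps_def
      torus_affine_comp torus_affine_eq_iff add.commute)

lemma subgroup_linear_maps: "subgroup linear_maps preim"
proof -
  interpret group preim by (rule group_preim)
  show ?thesis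
  proof (rule subgroupI)
    show sub: "linear_maps \<subseteq> carrier preim" unfolding linear_maps_def carrier_preim by blast
    show "linear_maps \<noteq> {}" using mats_one by (auto simp: linear_maps_def)
    fix f assume f: "f \<in> linear_maps"
    then obtain B where B: "B \<in> mats" "f = torus_affine B 0" by (auto simp: linear_maps_def)
    obtain A where A: "A \<in> mats" "B ** A = mat 1" "A ** B = mat 1"
      using B(1) by (rule mats_inverse)
    have A_in: "torus_affine A 0 \<in> linear_maps" using A(1) by (auto simp: linear_maps_def)
    have "inv\<^bsub>preim\<^esub> f = torus_affine A 0"
      using f A_in sub A by (intro inv_equality) (auto simp: B torus_affine_comp torus_affine_id)
    then show "inv\<^bsub>preim\<^esub> f \<in> linear_maps" using A_in by simp
  next
    fix f g assume "f \<in> linear_maps" "g \<in> linear_maps"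
    then show "f \<otimes>\<^bsub>preim\<^esub> g \<in> linear_maps"
      using mats_mult by (auto simp: linear_maps_def torus_affine_comp)
  qed
qed

text \<open>Every affine map is a linear map followed by a translation, and uniqueness of the linear
  part and the constant makes the intersection trivial.\<close>

lemma internal_semidirect_preim: "internal_semidirect preim translation_maps linear_maps"
  unfolding internal_semidirect_def
proof (intro conjI normal_translation_maps subgroup_linear_maps)
  have "torus_affine (mat 1) c \<circ> torus_affine B 0 = torus_affine B c" for B :: "int ^ 'n ^ 'n" and c
    by (simp add: torus_affine_comp)
  then show "translation_maps <#>\<^bsub>preim\<^esub> linear_maps = carrier preim"
    unfolding set_mult_def carrier_preim translation_maps_def linear_maps_def by auto
  show "translation_maps \<inter> linear_maps = {\<one>\<^bsub>preim\<^esub>}"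
    using mats_one
    by (auto simp: translation_maps_def linear_maps_def torus_affine_eq_iff simp flip: torus_affine_id)
qed

text \<open>The explicit isomorphisms start at the torus and at \<open>mats\<close>; they are
  inverted as needed, and the linear maps reach \<open>\<Lambda>\<close> through
  \<open>mats\<close>.\<close>

lemma subgroup_isos:
  shows "preim\<lparr>carrier := translation_maps\<rparr> \<cong> (torus_group :: 'n torus monoid)"
    and "preim\<lparr>carrier := linear_maps\<rparr> \<cong> real_units\<lparr>carrier := \<Lambda>\<rparr>"
    and "real_units\<lparr>carrier := \<Lambda>\<rparr> \<cong> GL_int\<lparr>carrier := mats\<rparr>"
proof -
  have torus: "group (torus_group :: 'n torus monoid)"
    by (rule groupI) (auto simp: torus_group_def add.assoc intro: exI[of _ "- x" for x])
  show "preim\<lparr>carrier := translation_maps\<rparr> \<cong> (torus_group :: 'n torus monoid)"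
    using group.iso_sym[OF torus is_isoI[OF translations_iso]] .
  have mats: "group (GL_int\<lparr>carrier := mats\<rparr>)"
    using group_GL_int subgroup_mats by (rule group.subgroup_imp_group)
  have "preim\<lparr>carrier := linear_maps\<rparr> \<cong> GL_int\<lparr>carrier := mats\<rparr>"
    using group.iso_sym[OF mats is_isoI[OF linear_maps_iso]] .
  then show "preim\<lparr>carrier := linear_maps\<rparr> \<cong> real_units\<lparr>carrier := \<Lambda>\<rparr>"
    using is_isoI[OF eigenval_iso] by (rule iso_trans)
  show "real_units\<lparr>carrier := \<Lambda>\<rparr> \<cong> GL_int\<lparr>carrier := mats\<rparr>"
    using group.iso_sym[OF mats is_isoI[OF eigenval_iso]] .
qed

lemma comm_group_subgroups:
  shows "comm_group (real_units\<lparr>carrier := \<Lambda>\<rparr>)" and "comm_group (GL_int\<lparr>carrier := mats\<rparr>)"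
proof -
  show "comm_group (real_units\<lparr>carrier := \<Lambda>\<rparr>)"
    using group.subgroup_imp_group[OF _ subgroup_Lambda] comm_group_real_units
    by (intro group.group_comm_groupI) (auto simp: comm_group_def real_units_def)
  show "comm_group (GL_int\<lparr>carrier := mats\<rparr>)"
    using group.subgroup_imp_group[OF group_GL_int subgroup_mats]
    by (rule group.group_comm_groupI) (simp add: GL_int_def mats_commute)
qed

lemma Lambda_algebraic_int:
  assumes "x \<in> \<Lambda>"
  shows "algebraic_int x" and "algebraic_int_degree x \<le> CARD('n)"
proof -
  obtain B where "B \<in> mats" "x = eigenval a B"
    using assms bij_betw_eigenval unfolding bij_betw_def by blast
  then have "real_mat B *v a = x *\<^sub>R a" using eigenval_eigenvector(1)[OF _ a_nz] by (simp add: mats_def)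
  then show "algebraic_int x" and "algebraic_int_degree x \<le> CARD('n)"
    using eigenvalue_algebraic_int a_nz by blast+
qed

end

theorem theorem5p5:
  fixes a :: "real ^ 'n"
    and X :: "'n vfield"
    and \<phi> :: "real \<Rightarrow> 'n torus \<Rightarrow> 'n torus"
    and \<Lambda> :: "real set"
  assumes "CARD('n) \<ge> 2"
    and "X = constant_field a"
    and "independent_over_rat a"
    and "flow_generated_by X \<phi>"
    and "subgroup \<Lambda> (multiplier_group X \<phi>)"
    and "\<Lambda> \<noteq> {1}"
  shows "\<exists>N H. internal_semidirect (multiplier_preimage X \<phi> \<Lambda>) N H \<and>
    (multiplier_preimage X \<phi> \<Lambda>)\<lparr>carrier := N\<rparr> \<cong> (torus_group :: 'n torus monoid) \<and>
    (\<exists>K. subgroup K real_units \<and> comm_group (real_units\<lparr>carrier := K\<rparr>) \<and>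
      (\<forall>x\<in>K. algebraic_int x \<and> algebraic_int_degree x \<le> CARD('n)) \<and>
      (multiplier_preimage X \<phi> \<Lambda>)\<lparr>carrier := H\<rparr> \<cong> real_units\<lparr>carrier := K\<rparr> \<and>
      (\<exists>M. subgroup M (GL_int :: (int ^ 'n ^ 'n) monoid) \<and>
        comm_group ((GL_int :: (int ^ 'n ^ 'n) monoid)\<lparr>carrier := M\<rparr>) \<and>
        real_units\<lparr>carrier := K\<rparr> \<cong> (GL_int :: (int ^ 'n ^ 'n) monoid)\<lparr>carrier := M\<rparr>))"
proof -
  interpret irrational_flow_subgroup a \<phi> \<Lambda>
    using assms by (intro irrational_flow_subgroup.intro) simp_all
  \<comment> \<open>The witnesses are \<open>translation_maps\<close> for \<open>N\<close>,
    \<open>linear_maps\<close> for \<open>H\<close>, \<open>\<Lambda>\<close> itself for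
    \<open>K\<close> and \<open>mats\<close> for \<open>M\<close>.\<close>
  show ?thesis
    unfolding \<open>X = constant_field a\<close>
    using internal_semidirect_preim subgroup_isos subgroup_Lambda subgroup_mats
      comm_group_subgroups Lambda_algebraic_int
    by meson
qed

end
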